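(* The monoids $L_3^1$ and $L_5^1$ are non-finitely based, while the sets $\operatorname{Isot}(L_3^1)$ and $\operatorname{Isot}(L_5^1)$ of their isoterms are finitely based.
   Context: For $\ell\ge 2$, $L_\ell=\langle a,b\mid aa=a,\ bb=b,\ \underbrace{ababab\cdots}_{\text{length }\ell}=0\rangle$ is the semigroup with zero $0$ generated by two idempotents subject to the relation that the alternating word $abab\cdots$ of length $\ell$ equals $0$; $L_\ell^1$ is the monoid obtained by adjoining an identity element to $L_\ell$. Monoids are regarded as semigroups. A semigroup is finitely based if all its identities can be deduced from a finite subset of its identities, and non-finitely based otherwise. $\mathfrak A$ is a countably infinite alphabet of variables. A word $\mathbf u$ is an isoterm for a semigroup $S$ if $\mathbf u=\mathbf v$ whenever $S$ satisfies the identity $\mathbf u\approx\mathbf v$. For a monoid $M$, $\operatorname{Isot}(M)$ is the set of all words in the free monoid $\mathfrak A^*$ that are isoterms for $M$. For a set of words $W\subseteq\mathfrak A^*$, $S^1(W)$ is the Rees quotient of $\mathfrak A^*$ over the ideal of all words that are not (contiguous) subwords of words in $W$. A set of words $W$ is called (non-)finitely based if the monoid $S^1(W)$ is (non-)finitely based. *)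

theory Defs
  imports "HOL-Algebra.Group" "HOL-Library.Sublist"
begin

section \<open>Semigroups and their identities\<close>

text \<open>HOL-Algebra has no record for semigroups without a distinguished identity element.\<close>

record 'a semigrp = "'a partial_object" +
  sg_mult :: "'a \<Rightarrow> 'a \<Rightarrow> 'a" (infixl \<open>\<cdot>\<index>\<close> 70)

definition semigroup_of :: "('a, 'm) monoid_scheme \<Rightarrow> 'a semigrp" where
  "semigroup_of M = \<lparr>carrier = carrier M, sg_mult = mult M\<rparr>"

text \<open>The countably infinite alphabet of variables is \<^typ>\<open>nat\<close>.\<close>

type_synonym word = "nat list"

text \<open>The value of a nonempty word; the empty word has no value in a semigroup.\<close>

fun sg_eval :: "('a, 'm) semigrp_scheme \<Rightarrow> (nat \<Rightarrow> 'a) \<Rightarrow> word \<Rightarrow> 'a" where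
  "sg_eval S \<phi> [] = undefined"
| "sg_eval S \<phi> [x] = \<phi> x"
| "sg_eval S \<phi> (x # y # w) = \<phi> x \<cdot>\<^bsub>S\<^esub> sg_eval S \<phi> (y # w)"

definition sg_identities :: "('a, 'm) semigrp_scheme \<Rightarrow> (word \<times> word) set" where
  "sg_identities S = {(u, v). u \<noteq> [] \<and> v \<noteq> [] \<and>
     (\<forall>\<phi> \<in> UNIV \<rightarrow> carrier S. sg_eval S \<phi> u = sg_eval S \<phi> v)}"

definition subst :: "(nat \<Rightarrow> word) \<Rightarrow> word \<Rightarrow> word" where
  "subst \<theta> w = concat (map \<theta> w)"

text \<open>Equational deduction in the signature of semigroups: variables are replaced by nonempty
  words only.\<close>

inductive deducible :: "(word \<times> word) set \<Rightarrow> word \<Rightarrow> word \<Rightarrow> bool" for \<Sigma> where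
  hyp: "(u, v) \<in> \<Sigma> \<Longrightarrow> deducible \<Sigma> u v"
| refl: "u \<noteq> [] \<Longrightarrow> deducible \<Sigma> u u"
| sym: "deducible \<Sigma> u v \<Longrightarrow> deducible \<Sigma> v u"
| trans: "deducible \<Sigma> u v \<Longrightarrow> deducible \<Sigma> v w \<Longrightarrow> deducible \<Sigma> u w"
| cong: "deducible \<Sigma> u v \<Longrightarrow> deducible \<Sigma> u' v' \<Longrightarrow> deducible \<Sigma> (u @ u') (v @ v')"
| inst: "deducible \<Sigma> u v \<Longrightarrow> (\<forall>x. \<theta> x \<noteq> []) \<Longrightarrow> deducible \<Sigma> (subst \<theta> u) (subst \<theta> v)"

definition finitely_based :: "('a, 'm) semigrp_scheme \<Rightarrow> bool" where
  "finitely_based S \<longleftrightarrow> (\<exists>\<Sigma>. finite \<Sigma> \<and> \<Sigma> \<subseteq> sg_identities S \<and>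
     (\<forall>(u, v) \<in> sg_identities S. deducible \<Sigma> u v))"


section \<open>Isoterms of a monoid\<close>

text \<open>Isoterms are taken in the free monoid, so here the empty word is admitted and has the
  value \<open>\<one>\<close>.\<close>

definition m_eval :: "('a, 'm) monoid_scheme \<Rightarrow> (nat \<Rightarrow> 'a) \<Rightarrow> word \<Rightarrow> 'a" where
  "m_eval M \<phi> w = foldr (\<lambda>x p. \<phi> x \<otimes>\<^bsub>M\<^esub> p) w \<one>\<^bsub>M\<^esub>"

lemma m_eval_eq_sg_eval:
  assumes "monoid M" "\<phi> \<in> UNIV \<rightarrow> carrier M" "w \<noteq> []"
  shows "m_eval M \<phi> w = sg_eval (semigroup_of M) \<phi> w"
  using assms(3)
proof (induction w rule: induct_list012)
  case (2 x)
  then show ?case using assms(1,2) by (auto simp: m_eval_def Pi_iff monoid.r_one)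
qed (simp_all add: m_eval_def semigroup_of_def)

definition m_satisfies :: "('a, 'm) monoid_scheme \<Rightarrow> word \<Rightarrow> word \<Rightarrow> bool" where
  "m_satisfies M u v \<longleftrightarrow> (\<forall>\<phi> \<in> UNIV \<rightarrow> carrier M. m_eval M \<phi> u = m_eval M \<phi> v)"

definition Isot :: "('a, 'm) monoid_scheme \<Rightarrow> word set" where
  "Isot M = {u. \<forall>v. m_satisfies M u v \<longrightarrow> u = v}"


section \<open>Quotients\<close>

text \<open>For a congruence \<open>\<rho>\<close> the union below is the single class of the products.\<close>

definition class_mult :: "('a \<Rightarrow> 'a \<Rightarrow> 'a) \<Rightarrow> ('a \<times> 'a) set \<Rightarrow> 'a set \<Rightarrow> 'a set \<Rightarrow> 'a set" where
  "class_mult f \<rho> A B = (\<Union>x \<in> A. \<Union>y \<in> B. \<rho> `` {f x y})"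

definition sg_quotient :: "('a, 'm) semigrp_scheme \<Rightarrow> ('a \<times> 'a) set \<Rightarrow> 'a set semigrp" where
  "sg_quotient S \<rho> = \<lparr>carrier = carrier S // \<rho>, sg_mult = class_mult (sg_mult S) \<rho>\<rparr>"

definition m_quotient :: "('a, 'm) monoid_scheme \<Rightarrow> ('a \<times> 'a) set \<Rightarrow> 'a set monoid" where
  "m_quotient M \<rho> =
     \<lparr>carrier = carrier M // \<rho>, mult = class_mult (mult M) \<rho>, one = \<rho> `` {\<one>\<^bsub>M\<^esub>}\<rparr>"

inductive_set generated_congruence ::
  "('a, 'm) semigrp_scheme \<Rightarrow> ('a \<times> 'a) set \<Rightarrow> ('a \<times> 'a) set" for S R where
  base: "(x, y) \<in> R \<Longrightarrow> x \<in> carrier S \<Longrightarrow> y \<in> carrier S \<Longrightarrow> (x, y) \<in> generated_congruence S R"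
| refl: "x \<in> carrier S \<Longrightarrow> (x, x) \<in> generated_congruence S R"
| sym: "(x, y) \<in> generated_congruence S R \<Longrightarrow> (y, x) \<in> generated_congruence S R"
| trans: "(x, y) \<in> generated_congruence S R \<Longrightarrow> (y, z) \<in> generated_congruence S R
    \<Longrightarrow> (x, z) \<in> generated_congruence S R"
| mult: "(x, y) \<in> generated_congruence S R \<Longrightarrow> (x', y') \<in> generated_congruence S R
    \<Longrightarrow> (x \<cdot>\<^bsub>S\<^esub> x', y \<cdot>\<^bsub>S\<^esub> y') \<in> generated_congruence S R"

definition rees_congruence :: "('a, 'm) monoid_scheme \<Rightarrow> 'a set \<Rightarrow> ('a \<times> 'a) set" where
  "rees_congruence M I = {(x, y) \<in> carrier M \<times> carrier M. x = y \<or> x \<in> I \<and> y \<in> I}"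


section \<open>The monoids \<open>S\<^sup>1(W)\<close>\<close>

definition free_monoid :: "'a list monoid" where
  "free_monoid = \<lparr>carrier = UNIV, mult = (@), one = []\<rparr>"

definition S1 :: "word set \<Rightarrow> word set monoid" where
  "S1 W = m_quotient free_monoid (rees_congruence free_monoid {u. \<not> (\<exists>w \<in> W. sublist u w)})"

definition finitely_based_words :: "word set \<Rightarrow> bool" where
  "finitely_based_words W \<longleftrightarrow> finitely_based (semigroup_of (S1 W))"


section \<open>The semigroups \<open>L\<^sub>\<ell>\<close> and the monoids \<open>L\<^sub>\<ell>\<^sup>1\<close>\<close>

text \<open>The free semigroup with zero: nonempty words \<^term>\<open>Some w\<close> together with the zero
  \<^term>\<open>None\<close>.\<close>

fun mult0 :: "'g list option \<Rightarrow> 'g list option \<Rightarrow> 'g list option" where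
  "mult0 (Some u) (Some v) = Some (u @ v)"
| "mult0 _ _ = None"

definition free_semigroup0 :: "'g list option semigrp" where
  "free_semigroup0 = \<lparr>carrier = insert None (Some ` {w. w \<noteq> []}), sg_mult = mult0\<rparr>"

datatype gen = a | b

definition alternating :: "nat \<Rightarrow> gen list" where
  "alternating l = map (\<lambda>i. if even i then a else b) [0..<l]"

definition L_relations :: "nat \<Rightarrow> (gen list option \<times> gen list option) set" where
  "L_relations l =
     {(Some [a, a], Some [a]), (Some [b, b], Some [b]), (Some (alternating l), None)}"

definition L :: "nat \<Rightarrow> gen list option set semigrp" where
  "L l = sg_quotient free_semigroup0 (generated_congruence free_semigroup0 (L_relations l))"

hide_const (open) a b

text \<open>A new identity element \<^term>\<open>None\<close> is adjoined, whether or not there already is one.\<close>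

fun mult1 :: "('a \<Rightarrow> 'a \<Rightarrow> 'a) \<Rightarrow> 'a option \<Rightarrow> 'a option \<Rightarrow> 'a option" where
  "mult1 f None y = y"
| "mult1 f x None = x"
| "mult1 f (Some x) (Some y) = Some (f x y)"

definition adjoin_one :: "('a, 'm) semigrp_scheme \<Rightarrow> 'a option monoid" where
  "adjoin_one S =
     \<lparr>carrier = insert None (Some ` carrier S), mult = mult1 (sg_mult S), one = None\<rparr>"

definition L1 :: "nat \<Rightarrow> gen list option set option monoid" where
  "L1 l = adjoin_one (L l)"

end

theory Submission
  imports Defs
begin

text \<open>Every element of \<open>L\<^sub>l\<^sup>1\<close> is the image of a word over the two generators, and two such words have the
same image iff both contain \<open>abab\<dots>\<close> (length \<open>l\<close>) as a scattered subword or both become equal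
when blocks of equal letters are contracted (\<open>L1_word_eq_iff\<close>). So an identity can be tested by
substituting words over \<open>{a, b}\<close> for the variables. A variable occurring often may only be sent to a
power of one generator unless the value is to be zero, and two variables sent to different
generators must not alternate often.

Isoterms. Let \<open>l = 2k + 1\<close> with \<open>k \<le> 2\<close>. Sending two variables to \<open>a\<close> and \<open>b\<close> and all others to
\<open>1\<close> reveals in \<open>L\<^sub>l\<^sup>1\<close> the relative order of all occurrences of these two variables, as long as
each occurs at most \<open>k\<close> times; and a word is determined by its restrictions to pairs of variables. If a
variable occurs more than \<open>k\<close> times, each of its occurrences can be doubled. Hence the isoterms are exactly the words
in which every letter occurs at most \<open>k\<close> times (\<open>Isot_L1\<close>). In the monoid defined by these words
a variable with more than \<open>k\<close> occurrences makes the value zero unless it is sent to \<open>1\<close>, so its occurrences may be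
gathered anywhere in the word; the finitely many identities that gather them, of length bounded
in terms of \<open>k\<close>, form a basis (\<open>bounded_words_finitely_based\<close>).

Non-finite basis, for every \<open>l \<ge> 3\<close>. Take variables \<open>c, w\<close> on one side and \<open>z, g\<^sub>0, \<dots>, g\<^sub>n\<^sub>-\<^sub>1\<close> on the other.
Two words, \<open>zigzag_g\<close> and \<open>zigzag_w\<close>, are built such that any two variables from different
sides alternate more than \<open>l\<close> times, whereas the restrictions to one side are, up to
contraction, the same: \<open>c w c\<close> and \<open>z g\<^sub>0 \<dots> g\<^sub>n\<^sub>-\<^sub>1 \<dots> g\<^sub>0 z\<close>. Thus the two words form an identity
(\<open>zigzag_identity\<close>), although every \<open>g\<^sub>i\<close> starts before \<open>w\<close> in the first and after \<open>w\<close> in the second.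
In any word equal to them over \<open>L\<^sub>3\<^sup>1\<close> either all \<open>g\<^sub>i\<close> start before \<open>w\<close> or none does
(\<open>zigzag_rigid\<close>): the letter \<open>c\<close> has to occur within the span of each \<open>g\<^sub>i\<close> but not within that
of \<open>w\<close>, and for \<open>z\<close> it is the other way round. An identity with fewer than \<open>n\<close> variables cannot
change this order (\<open>short_identity_preserves_order\<close>). Two of the \<open>g\<^sub>i\<close> would have to start in the image
of the same variable \<open>x\<close>; the spans of the \<open>g\<^sub>i\<close> are nested without crossing, so no factor
containing two of them occurs twice, and \<open>x\<close> is linear in the identity; but a linear variable keeps the set
of variables that precede it. Since \<open>L\<^sub>3\<^sup>1\<close> satisfies all identities of \<open>L\<^sub>l\<^sup>1\<close>, no finite set of
identities of \<open>L\<^sub>l\<^sup>1\<close> yields all these pairs.\<close>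

section \<open>Normal forms of words over the generators\<close>

text \<open>The words that represent zero. Scattered subwords give the same notion as factors of the
contracted word, but are easier to compose.\<close>

definition killed :: "nat \<Rightarrow> gen list \<Rightarrow> bool" where
  "killed l w \<longleftrightarrow> subseq (alternating l) w"

definition nf :: "nat \<Rightarrow> gen list \<Rightarrow> gen list option" where
  "nf l w = (if killed l w then None else Some (remdups_adj w))"

lemma length_alternating [simp]: "length (alternating l) = l"
  by (simp add: alternating_def)

lemma alternating_Suc: "alternating (Suc l) = alternating l @ [if even l then gen.a else gen.b]"
  by (simp add: alternating_def)

lemma hd_alternating: "0 < l \<Longrightarrow> hd (alternating l) = gen.a"
  by (simp add: alternating_def hd_map)

lemma last_alternating: "last (alternating (Suc l)) = (if even l then gen.a else gen.b)"
  by (simp add: alternating_Suc)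

lemma distinct_adj_alternating: "distinct_adj (alternating l)"
proof (induction l)
  case (Suc l)
  then show ?case
    by (cases l) (auto simp: alternating_Suc distinct_adj_append_iff alternating_def)
qed (simp add: alternating_def)

lemma prefix_alternating: "l \<le> l' \<Longrightarrow> \<exists>q. alternating l' = alternating l @ q"
  by (induction rule: dec_induct) (auto simp: alternating_Suc)

text \<open>A subword without equal neighbours uses at most one letter of each block.\<close>

lemma subseq_remdups_adj_iff:
  assumes "distinct_adj xs"
  shows "subseq xs (remdups_adj ys) \<longleftrightarrow> subseq xs ys"
  using assms
proof (induction ys arbitrary: xs rule: remdups_adj.induct)
  case (3 x y ys)
  show ?case
  proof (cases "x = y")
    case True
    have "subseq xs (y # ys)" if "subseq xs (y # y # ys)"
      using that 3(3) by (cases xs) (auto elim!: list_emb.cases[of _ _ "_ # _"] split: if_splits)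
    then show ?thesis using 3 True by auto
  next
    case False
    show ?thesis
    proof (cases xs)
      case (Cons x' xs')
      then have "distinct_adj xs'" using 3(3) by (metis distinct_adj_ConsD)
      then show ?thesis using 3 False Cons by (auto simp: subseq_Cons2_iff)
    qed simp
  qed
qed simp_all

lemma killed_remdups_adj: "killed l (remdups_adj w) \<longleftrightarrow> killed l w"
  by (simp add: killed_def subseq_remdups_adj_iff distinct_adj_alternating)

lemma remdups_adj_append_left: "remdups_adj (remdups_adj u @ v) = remdups_adj (u @ v)"
proof (induction u rule: remdups_adj.induct)
  case (3 x y xs)
  show ?case
  proof (cases "x = y")
    case False
    then have "remdups_adj (remdups_adj (y # xs) @ v) = remdups_adj (y # xs @ v)"
      using 3 by simp
    then show ?thesis
      using False remdups_adj_Cons[of x "remdups_adj (y # xs) @ v"] remdups_adj_Cons[of x "y # xs @ v"]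
      by simp
  qed (use 3 in simp)
qed simp_all

lemma remdups_adj_append_right: "remdups_adj (u @ remdups_adj v) = remdups_adj (u @ v)"
  by (metis remdups_adj_append_left remdups_adj_rev rev_append rev_rev_ident)

lemma remdups_adj_append_cong:
  assumes "remdups_adj u = remdups_adj u'" "remdups_adj v = remdups_adj v'"
  shows "remdups_adj (u @ v) = remdups_adj (u' @ v')"
  by (metis assms remdups_adj_append_left remdups_adj_append_right)

lemma remdups_adj_single:
  assumes "set u \<subseteq> {x}" "set u = set v"
  shows "remdups_adj u = remdups_adj v"
proof -
  have "u = replicate (length u) x" "v = replicate (length v) x"
    using assms by (auto intro: replicate_eqI)
  then show ?thesis
    using assms(2) remdups_adj_replicate by (metis length_0_conv set_empty)
qed

lemma not_both_gens: "\<not> {gen.a, gen.b} \<subseteq> T \<Longrightarrow> \<exists>x. T \<subseteq> {x}"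
  by (metis gen.exhaust insertI1 insert_subset subsetI empty_subsetI singletonD)

lemma killed_append: "killed l u \<or> killed l v \<Longrightarrow> killed l (u @ v)"
  unfolding killed_def by auto

lemma nf_eq_iff:
  "nf l u = nf l v \<longleftrightarrow> killed l u \<and> killed l v \<or> remdups_adj u = remdups_adj v"
  by (auto simp: nf_def) (metis killed_remdups_adj)+

lemma nf_append_cong:
  assumes "nf l u = nf l u'" "nf l v = nf l v'"
  shows "nf l (u @ v) = nf l (u' @ v')"
  using assms remdups_adj_append_cong killed_append unfolding nf_eq_iff by blast

lemma nf_mono:
  assumes "nf l u = nf l v" "l' \<le> l"
  shows "nf l' u = nf l' v"
proof -
  obtain q where "alternating l = alternating l' @ q"
    using prefix_alternating[OF assms(2)] by blast
  then have "subseq (alternating l') (alternating l)"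
    by (metis prefixI prefix_imp_subseq)
  then have "killed l w \<Longrightarrow> killed l' w" for w
    unfolding killed_def by (rule subseq_order.trans)
  then show ?thesis using assms(1) unfolding nf_eq_iff by blast
qed

section \<open>Elements of the monoids as images of words\<close>


abbreviation L_congruence :: "nat \<Rightarrow> (gen list option \<times> gen list option) set" where
  "L_congruence l \<equiv> generated_congruence free_semigroup0 (L_relations l)"

lemma nf_eq_if_L_congruent:
  assumes "(x, y) \<in> L_congruence l"
  shows "Option.bind x (nf l) = Option.bind y (nf l)"
  using assms
proof induction
  case (base x y)
  then show ?case by (auto simp: L_relations_def nf_eq_iff) (auto simp: nf_def killed_def)
next
  case (mult x y x' y')
  have "nf l u = None \<Longrightarrow> nf l (u @ v) = None" "nf l v = None \<Longrightarrow> nf l (u @ v) = None" for u v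
    using killed_append by (auto simp: nf_def split: if_splits)
  with mult.IH show ?case
    by (cases x; cases y; cases x'; cases y')
      (auto simp: free_semigroup0_def intro!: nf_append_cong dest: sym)
qed auto

lemma sg_mult_free [simp]: "sg_mult free_semigroup0 = mult0"
  and carrier_free: "carrier free_semigroup0 = insert None (Some ` {w. w \<noteq> []})"
  by (simp_all add: free_semigroup0_def)

lemma L_congruent_append:
  assumes "(Some u, x) \<in> L_congruence l" "(Some v, y) \<in> L_congruence l"
  shows "(Some (u @ v), mult0 x y) \<in> L_congruence l"
  using generated_congruence.mult[OF assms] by simp

lemma L_congruent_refl: "w \<noteq> [] \<Longrightarrow> (Some w, Some w) \<in> L_congruence l"
  by (rule generated_congruence.refl) (simp add: carrier_free)

lemma L_congruent_remdups_adj: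
  "w \<noteq> [] \<Longrightarrow> (Some w, Some (remdups_adj w)) \<in> L_congruence l"
proof (induction w rule: remdups_adj.induct)
  case (2 x)
  then show ?case by (simp add: L_congruent_refl)
next
  case (3 x y xs)
  have idem: "(Some [x, x], Some [x]) \<in> L_congruence l"
    by (cases x; rule generated_congruence.base) (auto simp: L_relations_def carrier_free)
  show ?case
  proof (cases "x = y")
    case True
    have "(Some (x # x # xs), Some (x # xs)) \<in> L_congruence l"
      using L_congruent_append[OF idem L_congruent_refl[of xs]] idem by (cases "xs = []") auto
    then show ?thesis using 3 True by (auto intro: generated_congruence.trans)
  next
    case False
    then show ?thesis
      using L_congruent_append[OF L_congruent_refl[of "[x]"] 3(2)] by simp
  qed
qed simp

lemma distinct_adj_eq_alternating:
  "distinct_adj w \<Longrightarrow> w \<noteq> [] \<Longrightarrow> hd w = gen.a \<Longrightarrow> w = alternating (length w)"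
proof (induction w rule: rev_induct)
  case (snoc x w)
  show ?case
  proof (cases "w = []")
    case True
    then show ?thesis using snoc by (simp add: alternating_def)
  next
    case False
    then have w: "w = alternating (length w)" and "last w \<noteq> x"
      using snoc by (simp_all add: distinct_adj_append_iff)
    obtain k where k: "length w = Suc k" using False by (cases w) auto
    then have "last w = (if even k then gen.a else gen.b)"
      using w last_alternating by metis
    then have "x = (if even (length w) then gen.a else gen.b)"
      using \<open>last w \<noteq> x\<close> k by (cases x) (auto split: if_splits)
    then show ?thesis
      using w alternating_Suc[of "length w"] by simp
  qed
qed simp

text \<open>A contracted word over two letters is alternating, possibly after a leading \<open>b\<close>. So once it is long
enough to contain the alternating word as a subword, it contains it as a factor, to which the
relation applies.\<close>

lemma factor_alternating:
  assumes "distinct_adj w" "subseq (alternating l) w" "0 < l"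
  shows "\<exists>p q. w = p @ alternating l @ q"
proof -
  have *: "\<exists>q. v = alternating l @ q"
    if "distinct_adj v" "subseq (alternating l) v" "hd v = gen.a" for v
  proof -
    have "v \<noteq> []" using that(2) \<open>0 < l\<close> by (auto simp: alternating_def)
    then show ?thesis
      using distinct_adj_eq_alternating[OF that(1) _ that(3)] prefix_alternating[of l "length v"]
        list_emb_length[OF that(2)] by simp
  qed
  show ?thesis
  proof (cases "hd w = gen.a")
    case True
    then show ?thesis using * assms by (metis append_Nil)
  next
    case False
    obtain x v where w: "w = x # v" using assms(2,3) by (cases w) (auto simp: alternating_def)
    obtain r where r: "alternating l = gen.a # r"
      using hd_alternating[OF assms(3)] assms(3) length_alternating[of l]
      by (metis hd_Cons_tl length_0_conv less_irrefl)
    have sv: "subseq (alternating l) v"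
      using assms(2) w False r by (auto simp: subseq_Cons2_iff)
    then obtain y v' where v: "v = y # v'" using r by (cases v) auto
    have "hd v = gen.a"
      using assms(1) False by (simp add: w v) (metis gen.exhaust)
    then obtain q where "v = alternating l @ q"
      using * sv assms(1) w by (metis distinct_adj_ConsD)
    then show ?thesis using w by (metis append_Cons append_Nil)
  qed
qed

lemma L_congruent_None:
  assumes "killed l w" "0 < l"
  shows "(Some w, None) \<in> L_congruence l"
proof -
  have "w \<noteq> []" using assms by (auto simp: killed_def alternating_def)
  obtain p q where pq: "remdups_adj w = p @ alternating l @ q"
    using factor_alternating[of "remdups_adj w" l] assms
    by (auto simp: killed_def subseq_remdups_adj_iff distinct_adj_alternating)
  have alt: "(Some (alternating l), None) \<in> L_congruence l"
    using assms(2) by (intro generated_congruence.base)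
      (auto simp: L_relations_def carrier_free alternating_def)
  have "(Some (alternating l @ q), None) \<in> L_congruence l"
    using L_congruent_append[OF alt L_congruent_refl[of q]] alt by (cases "q = []") auto
  then have "(Some (p @ alternating l @ q), None) \<in> L_congruence l"
    using L_congruent_append[OF L_congruent_refl[of p]] by (cases "p = []") fastforce+
  then show ?thesis
    using L_congruent_remdups_adj[OF \<open>w \<noteq> []\<close>] pq generated_congruence.trans by metis
qed

lemma L_congruent_iff:
  assumes "u \<noteq> []" "v \<noteq> []" "0 < l"
  shows "(Some u, Some v) \<in> L_congruence l \<longleftrightarrow> nf l u = nf l v"
proof
  assume "nf l u = nf l v"
  then consider "killed l u" "killed l v" | "remdups_adj u = remdups_adj v"
    unfolding nf_eq_iff by blast
  then show "(Some u, Some v) \<in> L_congruence l"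
  proof cases
    case 1
    then show ?thesis using L_congruent_None assms(3)
      by (meson generated_congruence.sym generated_congruence.trans)
  next
    case 2
    then show ?thesis using L_congruent_remdups_adj assms
      by (metis generated_congruence.sym generated_congruence.trans)
  qed
qed (use nf_eq_if_L_congruent in fastforce)

lemma class_mult_class:
  assumes "sym \<rho>" "trans \<rho>" "(x, x) \<in> \<rho>" "(y, y) \<in> \<rho>"
    and cong: "\<And>x x' y y'. (x, x') \<in> \<rho> \<Longrightarrow> (y, y') \<in> \<rho> \<Longrightarrow> (f x y, f x' y') \<in> \<rho>"
  shows "class_mult f \<rho> (\<rho> `` {x}) (\<rho> `` {y}) = \<rho> `` {f x y}"
proof -
  have "\<rho> `` {f x' y'} = \<rho> `` {f x y}" if "(x, x') \<in> \<rho>" "(y, y') \<in> \<rho>" for x' y'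
    using cong[OF that] symD[OF assms(1)] transD[OF assms(2)] by blast
  moreover have "x \<in> \<rho> `` {x}" "y \<in> \<rho> `` {y}"
    using assms(3,4) by simp_all
  ultimately show ?thesis
    unfolding class_mult_def by blast
qed

text \<open>A monoid onto which words over some alphabet are mapped homomorphically. Assignments of
variables can then be replaced by substitutions of words; this covers both \<open>L\<^sub>l\<^sup>1\<close> and the
Rees quotients of the free monoid.\<close>

locale free_monoid_image =
  fixes M :: "('a, 'm) monoid_scheme" and h :: "'c list \<Rightarrow> 'a"
  assumes h_append: "h (u @ v) = h u \<otimes>\<^bsub>M\<^esub> h v"
    and h_Nil: "h [] = \<one>\<^bsub>M\<^esub>"
    and range_h: "range h = carrier M"
begin

lemma all_assignments:
  "(\<forall>\<phi> \<in> UNIV \<rightarrow> carrier M. Q \<phi>) \<longleftrightarrow> (\<forall>\<psi>. Q (\<lambda>x. h (\<psi> x)))" for Q :: "(nat \<Rightarrow> 'a) \<Rightarrow> bool"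
proof safe
  fix \<phi> :: "nat \<Rightarrow> 'a"
  assume *: "\<forall>\<psi>. Q (\<lambda>x. h (\<psi> x))" and "\<phi> \<in> UNIV \<rightarrow> carrier M"
  then have "\<forall>x. \<exists>w. h w = \<phi> x" using range_h by (metis PiE UNIV_I rangeE)
  then obtain \<psi> where "\<forall>x. h (\<psi> x) = \<phi> x" by metis
  then have "(\<lambda>x. h (\<psi> x)) = \<phi>" by auto
  with * show "Q \<phi>" by metis
qed (use range_h in auto)

lemma m_eval_image: "m_eval M (\<lambda>x. h (\<psi> x)) w = h (concat (map \<psi> w))"
  by (induction w) (simp_all add: m_eval_def h_append h_Nil)

lemma sg_eval_image:
  "w \<noteq> [] \<Longrightarrow> sg_eval (semigroup_of M) (\<lambda>x. h (\<psi> x)) w = h (concat (map \<psi> w))"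
  by (induction w rule: induct_list012) (simp_all add: h_append semigroup_of_def)

lemma m_satisfies_iff:
  "m_satisfies M u v \<longleftrightarrow> (\<forall>\<psi>. h (concat (map \<psi> u)) = h (concat (map \<psi> v)))"
  unfolding m_satisfies_def all_assignments m_eval_image ..

lemma sg_identities_iff:
  "(u, v) \<in> sg_identities (semigroup_of M) \<longleftrightarrow> u \<noteq> [] \<and> v \<noteq> [] \<and> m_satisfies M u v"
proof -
  have "carrier (semigroup_of M) = carrier M" by (simp add: semigroup_of_def)
  then show ?thesis
    unfolding sg_identities_def m_satisfies_iff
    by (auto simp: all_assignments sg_eval_image)
qed

end

text \<open>The alternating word of length \<open>l\<close> has value zero, so words over the generators reach all elements.\<close>

definition L1_word :: "nat \<Rightarrow> gen list \<Rightarrow> gen list option set option" where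
  "L1_word l w = (if w = [] then None else Some (L_congruence l `` {Some w}))"

lemma L_congruence_sym: "sym (L_congruence l)"
  and L_congruence_trans: "trans (L_congruence l)"
  by (auto intro: symI transI generated_congruence.sym generated_congruence.trans)

lemma L1_image:
  assumes "0 < l"
  shows "free_monoid_image (L1 l) (L1_word l)"
proof
  show "L1_word l (u @ v) = L1_word l u \<otimes>\<^bsub>L1 l\<^esub> L1_word l v" for u v
  proof (cases "u = [] \<or> v = []")
    case True
    then show ?thesis
      by (cases "u = []"; cases "v = []") (auto simp: L1_word_def L1_def adjoin_one_def)
  next
    case False
    then have "class_mult mult0 (L_congruence l) (L_congruence l `` {Some u})
      (L_congruence l `` {Some v}) = L_congruence l `` {mult0 (Some u) (Some v)}"
      using generated_congruence.mult[where S = free_semigroup0 and R = "L_relations l"]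
      by (intro class_mult_class L_congruence_sym L_congruence_trans L_congruent_refl) simp_all
    with False show ?thesis
      by (simp add: L1_word_def L1_def adjoin_one_def L_def sg_quotient_def)
  qed
  show "L1_word l [] = \<one>\<^bsub>L1 l\<^esub>" by (simp add: L1_word_def L1_def adjoin_one_def)
  have "(Some (alternating l), None) \<in> L_congruence l"
    by (rule L_congruent_None) (use assms in \<open>auto simp: killed_def\<close>)
  then have zero: "L_congruence l `` {None} = L_congruence l `` {Some (alternating l)}"
    by (blast intro: generated_congruence.sym generated_congruence.trans)
  have "alternating l \<noteq> []" using assms by (metis length_alternating length_0_conv less_irrefl)
  then have "carrier (L l) = (\<lambda>w. L_congruence l `` {Some w}) ` {w. w \<noteq> []}"
    using zero by (auto simp: L_def sg_quotient_def quotient_def carrier_free)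
  then show "range (L1_word l) = carrier (L1 l)"
    by (auto simp: L1_def adjoin_one_def L1_word_def image_iff)
qed

lemma L1_word_eq_iff:
  assumes "0 < l"
  shows "L1_word l u = L1_word l v \<longleftrightarrow> nf l u = nf l v"
proof -
  have *: "nf l w = nf l [] \<longleftrightarrow> w = []" for w
    using assms by (cases w) (simp_all add: nf_eq_iff killed_def alternating_def)
  have "L_congruence l `` {Some u} = L_congruence l `` {Some v} \<longleftrightarrow> nf l u = nf l v"
    if "u \<noteq> []" "v \<noteq> []"
  proof -
    have "L_congruence l `` {Some u} = L_congruence l `` {Some v}
      \<longleftrightarrow> (Some u, Some v) \<in> L_congruence l"
      using L_congruent_refl[OF that(2), of l]
        symD[OF L_congruence_sym] transD[OF L_congruence_trans] by blast
    then show ?thesis using L_congruent_iff[OF that assms] by simp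
  qed
  then show ?thesis using *[of u] *[of v] by (cases "u = []"; cases "v = []") (auto simp: L1_word_def)
qed

lemma m_satisfies_L1_iff:
  assumes "0 < l"
  shows "m_satisfies (L1 l) u v
    \<longleftrightarrow> (\<forall>\<psi>. nf l (concat (map \<psi> u)) = nf l (concat (map \<psi> v)))"
  unfolding free_monoid_image.m_satisfies_iff[OF L1_image[OF assms]] L1_word_eq_iff[OF assms] ..

lemma m_satisfies_L1_mono:
  assumes "m_satisfies (L1 l) u v" "0 < l'" "l' \<le> l"
  shows "m_satisfies (L1 l') u v"
  using assms by (auto simp: m_satisfies_L1_iff intro: nf_mono)


section \<open>Substitutions and powers\<close>


abbreviation power_word :: "nat \<Rightarrow> 'c list \<Rightarrow> 'c list" where
  "power_word m u \<equiv> concat (replicate m u)"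

lemma nf_eq_killed: "nf l u = nf l v \<Longrightarrow> killed l u = killed l v"
  unfolding nf_eq_iff by (metis killed_remdups_adj)

lemma subseq_power_word: "subseq u v \<Longrightarrow> subseq (power_word m u) (power_word m v)"
  by (induction m) (auto intro: list_emb_append_mono)

lemma power_word_Suc_right: "power_word (Suc m) u = power_word m u @ u"
  by (induction m) auto

lemma alternating_odd: "alternating (Suc (2 * k)) = power_word k [gen.a, gen.b] @ [gen.a]"
proof (induction k)
  case (Suc k)
  have "power_word (Suc k) [gen.a, gen.b] = power_word k [gen.a, gen.b] @ [gen.a, gen.b]"
    by (rule power_word_Suc_right)
  with Suc show ?case
    by (simp add: alternating_Suc del: replicate_Suc)
qed (simp add: alternating_def)

text \<open>Each copy of \<open>y\<close> contributes \<open>ab\<close>, or each contributes \<open>ba\<close>; the word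
\<open>(ba)\<^sup>k\<^sup>+\<^sup>1\<close> also contains \<open>a(ba)\<^sup>k\<close>.\<close>

lemma killed_power_word:
  assumes "{gen.a, gen.b} \<subseteq> set y" "l \<le> Suc (2 * k)"
  shows "killed l (power_word (Suc k) y)"
proof -
  have shift: "power_word k [gen.a, gen.b] @ [gen.a] = gen.a # power_word k [gen.b, gen.a]"
    by (induction k) auto
  obtain p q where y: "y = p @ gen.a # q" using assms(1) split_list[of gen.a y] by auto
  have "gen.b \<in> set p \<or> gen.b \<in> set q" using assms(1) y by auto
  moreover have "subseq ([gen.b] @ [gen.a]) y" if "gen.b \<in> set p"
    unfolding y using that by (intro list_emb_append_mono) (simp_all add: subseq_singleton_left)
  moreover have "subseq ([] @ [gen.a, gen.b]) y" if "gen.b \<in> set q"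
    unfolding y using that by (intro list_emb_append_mono) (simp_all add: subseq_singleton_left)
  ultimately consider "subseq [gen.a, gen.b] y" | "subseq [gen.b, gen.a] y"
    by auto
  then have "subseq (alternating (Suc (2 * k))) (power_word (Suc k) y)"
  proof cases
    case 1
    then have "subseq (power_word k [gen.a, gen.b] @ [gen.a, gen.b]) (power_word k y @ y)"
      by (intro list_emb_append_mono subseq_power_word)
    moreover have "subseq (power_word k [gen.a, gen.b] @ [gen.a])
      (power_word k [gen.a, gen.b] @ [gen.a, gen.b])"
      by (intro list_emb_append_mono) simp_all
    ultimately show ?thesis
      unfolding alternating_odd power_word_Suc_right by (metis subseq_order.trans)
  next
    case 2
    then have "subseq ([gen.a] @ power_word k [gen.b, gen.a]) (y @ power_word k y)"
      by (intro list_emb_append_mono subseq_power_word) (auto dest: subseq_Cons')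
    then show ?thesis
      unfolding alternating_odd shift by simp
  qed
  moreover have "subseq (alternating l) (alternating (Suc (2 * k)))"
    using prefix_alternating[OF assms(2)] by auto
  ultimately show ?thesis
    unfolding killed_def by (metis subseq_order.trans)
qed

lemma concat_map_single: "concat (map (\<lambda>y. if y = x then r else []) u) = power_word (count_list u x) r"
  by (induction u) auto

lemma concat_map_power_word:
  "concat (map \<psi> (power_word m u)) = power_word m (concat (map \<psi> u))"
  by (induction m) auto

lemma concat_map_subst:
  "concat (map \<psi> (subst \<theta> u)) = concat (map (\<lambda>x. concat (map \<psi> (\<theta> x))) u)"
  by (induction u) (auto simp: subst_def)

lemma subseq_concat_map:
  "subseq u v \<Longrightarrow> subseq (concat (map \<psi> u)) (concat (map \<psi> v))"
  by (induction rule: list_emb.induct) (auto intro: list_emb_append_mono)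

lemma m_satisfies_L1_subst:
  assumes "m_satisfies (L1 l) u v" "0 < l"
  shows "m_satisfies (L1 l) (p @ subst \<theta> u @ q) (p @ subst \<theta> v @ q)"
  using assms by (auto simp: m_satisfies_L1_iff concat_map_subst intro!: nf_append_cong)

lemma m_satisfies_sym: "m_satisfies M u v \<Longrightarrow> m_satisfies M v u"
  and m_satisfies_trans: "m_satisfies M u v \<Longrightarrow> m_satisfies M v w \<Longrightarrow> m_satisfies M u w"
  by (simp_all add: m_satisfies_def)

lemma alternating_3: "alternating 3 = [gen.a, gen.b, gen.a]"
  by (simp add: alternating_def upt_rec)

section \<open>Invariants of identities of the monoid for length three\<close>


lemma m_satisfies_L1_killed:
  assumes "m_satisfies (L1 l) u v" "0 < l"
  shows "killed l (concat (map \<psi> u)) \<longleftrightarrow> killed l (concat (map \<psi> v))"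
  using assms by (intro nf_eq_killed) (simp add: m_satisfies_L1_iff)

lemma subseq_three_iff:
  "subseq [x, y, z] w \<longleftrightarrow> (\<exists>us vs. w = us @ y # vs \<and> x \<in> set us \<and> z \<in> set vs)"
proof
  assume "subseq [x, y, z] w"
  then obtain us1 w' where 1: "w = us1 @ x # w'" "subseq [y, z] w'"
    by (auto dest: list_emb_ConsD)
  then obtain us2 vs where "w' = us2 @ y # vs" "subseq [z] vs"
    by (auto dest: list_emb_ConsD)
  with 1 have "w = (us1 @ x # us2) @ y # vs" "z \<in> set vs"
    by (simp_all add: subseq_singleton_left)
  then show "\<exists>us vs. w = us @ y # vs \<and> x \<in> set us \<and> z \<in> set vs"
    by (metis in_set_conv_decomp)
next
  assume "\<exists>us vs. w = us @ y # vs \<and> x \<in> set us \<and> z \<in> set vs"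
  then obtain us vs where "w = us @ y # vs" "x \<in> set us" "z \<in> set vs" by blast
  moreover from this have "subseq ([x] @ y # [z]) (us @ y # vs)"
    by (intro list_emb_append_mono) (simp_all add: subseq_singleton_left)
  ultimately show "subseq [x, y, z] w" by simp
qed

text \<open>The substitutions in this and the following lemmas are chosen such that the property in question
decides whether the value is zero.\<close>

lemma L3_set_eq:
  assumes "m_satisfies (L1 3) u v"
  shows "set u = set v"
proof -
  have "killed 3 (concat (map (\<lambda>y. if y = x then alternating 3 else []) w)) \<longleftrightarrow> x \<in> set w" for x w
    unfolding concat_map_single
  proof (cases "count_list w x")
    case 0
    then show "killed 3 (power_word (count_list w x) (alternating 3)) \<longleftrightarrow> x \<in> set w"
      by (simp add: count_list_0_iff killed_def alternating_3)
  next
    case (Suc k)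
    then have "x \<in> set w" by (metis count_list_0_iff nat.distinct(1))
    then show "killed 3 (power_word (count_list w x) (alternating 3)) \<longleftrightarrow> x \<in> set w"
      by (simp add: Suc killed_def list_emb_prefix)
  qed
  then have "x \<in> set u \<longleftrightarrow> x \<in> set v" for x
    using m_satisfies_L1_killed[OF assms] by (metis zero_less_numeral)
  then show ?thesis by blast
qed

lemma L3_linear:
  assumes "m_satisfies (L1 3) u v"
  shows "count_list u x \<le> 1 \<longleftrightarrow> count_list v x \<le> 1"
proof -
  \<comment> \<open>The product \<open>ab\<close> is nonzero, its square is zero.\<close>
  have "killed 3 (concat (map (\<lambda>y. if y = x then [gen.a, gen.b] else []) w)) \<longleftrightarrow> \<not> count_list w x \<le> 1" for w
  proof (cases "count_list w x \<le> 1")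
    case True
    then consider "count_list w x = 0" | "count_list w x = 1" by linarith
    then show ?thesis unfolding concat_map_single by cases (auto simp: killed_def alternating_3)
  next
    case False
    then obtain k where k: "count_list w x = Suc (Suc k)" by (metis One_nat_def Suc_leI diff_Suc_1 le_0_eq not_less_eq_eq old.nat.exhaust)
    have "killed 3 (power_word (Suc (Suc k)) [gen.a, gen.b])"
      by (rule killed_power_word) auto
    then show ?thesis unfolding concat_map_single k using False k by simp
  qed
  then show ?thesis
    using m_satisfies_L1_killed[OF assms] by (metis zero_less_numeral)
qed

lemma count_list_le_1_split:
  assumes "x \<in> set u" "count_list u x \<le> 1"
  shows "\<exists>p q. u = p @ x # q \<and> x \<notin> set p \<and> x \<notin> set q"
proof -
  obtain p q where u: "u = p @ x # q" using split_list[OF assms(1)] by blast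
  then have "count_list p x = 0" "count_list q x = 0" using assms(2) by simp_all
  with u show ?thesis by (auto simp: count_list_0_iff)
qed

lemma L3_before_linear:
  assumes "m_satisfies (L1 3) (s1 @ x # s2) (t1 @ x # t2)"
    and "x \<notin> set s1" "x \<notin> set s2" "x \<notin> set t1" "x \<notin> set t2"
  shows "set s1 = set t1"
proof -
  \<comment> \<open>With \<open>x\<close> linear, the image is \<open>a\<^sup>i ba a\<^sup>j\<close>; it is zero iff \<open>i > 0\<close>.\<close>
  have "killed 3 (concat (map (\<lambda>v. if v = x then [gen.b, gen.a] else if v = y then [gen.a] else []) (p @ x # q)))
      \<longleftrightarrow> y \<in> set p" if "x \<notin> set p" "x \<notin> set q" "y \<noteq> x" for p q y
  proof -
    let ?\<psi> = "\<lambda>v. if v = x then [gen.b, gen.a] else if v = y then [gen.a] else []"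
    have image: "concat (map ?\<psi> r) = replicate (count_list r y) gen.a" if "x \<notin> set r" for r
      using that \<open>y \<noteq> x\<close> by (induction r) auto
    have w: "concat (map ?\<psi> (p @ x # q)) = replicate (count_list p y) gen.a
        @ gen.b # gen.a # replicate (count_list q y) gen.a"
      using image[OF that(1)] image[OF that(2)] by simp
    show ?thesis
    proof (cases "y \<in> set p")
      case True
      then have "gen.a \<in> set (replicate (count_list p y) gen.a)"
        using count_list_0_iff[of p y] by simp
      with True show ?thesis
        unfolding killed_def alternating_3 subseq_three_iff w by fastforce
    next
      case False
      have "False" if us: "gen.b # gen.a # replicate k gen.a = us @ gen.b # vs" "gen.a \<in> set us" for us vs k
      proof -
        obtain us' where "gen.a # replicate k gen.a = us' @ gen.b # vs"
          using us by (cases us) auto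
        then have "gen.b \<in> set (gen.a # replicate k gen.a)" by simp
        then show False by (simp split: if_splits)
      qed
      moreover have "count_list p y = 0" using False by (simp add: count_list_0_iff)
      ultimately show ?thesis
        using False unfolding killed_def alternating_3 subseq_three_iff w by auto
    qed
  qed
  note killed_iff = this
  have "y \<in> set s1 \<longleftrightarrow> y \<in> set t1" for y
  proof (cases "y = x")
    case False
    then show ?thesis
      using killed_iff[OF assms(2,3) False] killed_iff[OF assms(4,5) False]
        m_satisfies_L1_killed[OF assms(1), of "\<lambda>v. if v = x then [gen.b, gen.a]
          else if v = y then [gen.a] else []"]
      by (simp only: zero_less_numeral)
  qed (use assms in simp)
  then show ?thesis by blast
qed

text \<open>Some letter of \<open>B\<close> occurs in the span from the first to the last letter of \<open>A\<close>: the only way in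
which a substitution sending \<open>A\<close> to \<open>a\<close>, \<open>B\<close> to \<open>b\<close> and all other letters to \<open>1\<close> yields zero for length three.\<close>

definition enclosed :: "nat set \<Rightarrow> nat set \<Rightarrow> word \<Rightarrow> bool" where
  "enclosed B A u \<longleftrightarrow> (\<exists>x\<in>A. \<exists>y\<in>B. \<exists>x'\<in>A. subseq [x, y, x'] u)"

lemma concat_map_split:
  assumes "concat (map \<psi> u) = us @ z # vs" "\<And>x. length (\<psi> x) \<le> 1"
  shows "\<exists>p x q. u = p @ x # q \<and> concat (map \<psi> p) = us \<and> \<psi> x = [z] \<and> concat (map \<psi> q) = vs"
  using assms(1)
proof (induction u arbitrary: us)
  case (Cons x u)
  consider "\<psi> x = []" | z' where "\<psi> x = [z']"
    using assms(2)[of x] by (cases "\<psi> x") auto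
  then show ?case
  proof cases
    case 1
    then obtain p y q where "u = p @ y # q" "concat (map \<psi> p) = us" "\<psi> y = [z]" "concat (map \<psi> q) = vs"
      using Cons by fastforce
    with 1 show ?thesis by (intro exI[of _ "x # p"]) auto
  next
    case 2
    show ?thesis
    proof (cases us)
      case Nil
      with 2 Cons.prems show ?thesis by (intro exI[of _ "[]"]) auto
    next
      case (Cons z'' us')
      then obtain p y q where "u = p @ y # q" "concat (map \<psi> p) = us'" "\<psi> y = [z]" "concat (map \<psi> q) = vs"
        using Cons.IH[of us'] Cons.prems 2 by auto
      with 2 Cons Cons.prems show ?thesis by (intro exI[of _ "x # p"]) auto
    qed
  qed
qed simp

lemma L3_enclosed:
  assumes "m_satisfies (L1 3) u v" "A \<inter> B = {}"
  shows "enclosed B A u \<longleftrightarrow> enclosed B A v"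
proof -
  let ?\<psi> = "\<lambda>v. if v \<in> A then [gen.a] else if v \<in> B then [gen.b] else []"
  have image: "gen.a \<in> set (concat (map ?\<psi> r)) \<longleftrightarrow> A \<inter> set r \<noteq> {}" for r
    by auto
  have "killed 3 (concat (map ?\<psi> w)) \<longleftrightarrow> enclosed B A w" for w
  proof
    assume "killed 3 (concat (map ?\<psi> w))"
    then obtain us vs where *: "concat (map ?\<psi> w) = us @ gen.b # vs" "gen.a \<in> set us" "gen.a \<in> set vs"
      unfolding killed_def alternating_3 subseq_three_iff by blast
    have "length (?\<psi> x) \<le> 1" for x by simp
    then obtain p y q where "w = p @ y # q" "concat (map ?\<psi> p) = us" "?\<psi> y = [gen.b]"
        "concat (map ?\<psi> q) = vs"
      using concat_map_split[OF *(1)] by blast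
    then have "A \<inter> set p \<noteq> {}" "y \<in> B" "A \<inter> set q \<noteq> {}" "w = p @ y # q"
      using image[of p] image[of q] *(2,3) by (simp_all split: if_splits)
    then show "enclosed B A w"
      unfolding enclosed_def subseq_three_iff by fast
  next
    assume "enclosed B A w"
    then obtain x y x' p q where "x \<in> A" "y \<in> B" "x' \<in> A" "w = p @ y # q" "x \<in> set p" "x' \<in> set q"
      unfolding enclosed_def subseq_three_iff by blast
    moreover from this have "?\<psi> y = [gen.b]" using assms(2) by auto
    moreover have "concat (map ?\<psi> (p @ y # q)) = concat (map ?\<psi> p) @ ?\<psi> y @ concat (map ?\<psi> q)"
      by simp
    ultimately have "concat (map ?\<psi> w) = concat (map ?\<psi> p) @ gen.b # concat (map ?\<psi> q)"
      "gen.a \<in> set (concat (map ?\<psi> p))" "gen.a \<in> set (concat (map ?\<psi> q))"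
      unfolding image by (simp_all only: append.simps) blast+
    then show "killed 3 (concat (map ?\<psi> w))"
      unfolding killed_def alternating_3 subseq_three_iff by blast
  qed
  then show ?thesis
    using m_satisfies_L1_killed[OF assms(1), of ?\<psi>] by (simp only: zero_less_numeral)
qed

lemma set_subseq: "subseq u v \<Longrightarrow> set u \<subseteq> set v"
  by (induction rule: list_emb.induct) auto

lemma not_enclosed:
  assumes "u = p @ m @ q" "A \<inter> set p = {}" "A \<inter> set q = {}" "B \<inter> set m = {}"
  shows "\<not> enclosed B A u"
proof
  assume "enclosed B A u"
  then obtain x y x' where *: "x \<in> A" "y \<in> B" "x' \<in> A" "subseq [x, y, x'] (p @ m @ q)"
    unfolding enclosed_def assms(1) by blast
  then obtain us vs ws where split: "[x, y, x'] = us @ vs @ ws" "subseq us p" "subseq vs m" "subseq ws q"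
    unfolding subseq_append_iff by blast
  have sets: "set us \<subseteq> set p" "set vs \<subseteq> set m" "set ws \<subseteq> set q"
    using split(2-4) by (simp_all add: set_subseq)
  have "us = []"
    using split(1) sets(1) *(1) assms(2) by (cases us) auto
  moreover have "ws = []"
    using split(1) sets(3) *(3) assms(3) by (cases ws rule: rev_cases) (auto simp flip: append_assoc)
  ultimately have "y \<in> set vs" using arg_cong[OF split(1), of set] by auto
  with * sets assms(4) show False by blast
qed

section \<open>An identity in unboundedly many variables\<close>

text \<open>The letters of the construction. A blocker \<open>c\<close> separates \<open>w\<close> from the \<open>g\<^sub>i\<close> on one flank, and a
blocker \<open>z\<close> does so on the other.\<close>

abbreviation (input) "cv \<equiv> 0 :: nat"
abbreviation (input) "zv \<equiv> 1 :: nat"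
abbreviation (input) "wv \<equiv> 2 :: nat"
abbreviation (input) gv :: "nat \<Rightarrow> nat" where "gv i \<equiv> i + 3"

text \<open>Up to powers and further alternations these are \<open>cz \<cdot> g\<^sub>0 \<dots> g\<^sub>n\<^sub>-\<^sub>1 \<cdot> c w \<cdot> g\<^sub>n\<^sub>-\<^sub>1 \<dots> g\<^sub>0 \<cdot> z w \<cdot> cz\<close> and
\<open>cz \<cdot> w z \<cdot> g\<^sub>0 \<dots> g\<^sub>n\<^sub>-\<^sub>1 \<cdot> w c \<cdot> g\<^sub>n\<^sub>-\<^sub>1 \<dots> g\<^sub>0 \<cdot> cz\<close>; the powers make letters from
different sides alternate arbitrarily often without changing which letters of one side enclose which.\<close>

definition zigzag_g :: "nat \<Rightarrow> nat \<Rightarrow> word" where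
  "zigzag_g m n = power_word m [cv, zv] @
     concat (map (\<lambda>i. power_word m [gv i, cv]) [0..<n]) @
     concat (map (\<lambda>i. power_word m [wv, gv i]) (rev [0..<n])) @
     power_word m [zv, wv] @ power_word m [cv, zv]"

definition zigzag_w :: "nat \<Rightarrow> nat \<Rightarrow> word" where
  "zigzag_w m n = power_word m [cv, zv] @ power_word m [wv, zv] @
     concat (map (\<lambda>i. power_word m [gv i, wv]) [0..<n]) @
     concat (map (\<lambda>i. power_word m [cv, gv i]) (rev [0..<n])) @
     power_word m [cv, zv]"

lemma subseq_concat_member: "u \<in> set us \<Longrightarrow> subseq u (concat us)"
  by (induction us) auto

lemma zigzag_alternates:
  assumes "x \<in> {cv, wv}" "y \<in> insert zv (gv ` {..<n})"
  shows "\<exists>r. set r = {x, y} \<and> subseq (power_word m r) (zigzag_g m n)"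
    and "\<exists>r. set r = {x, y} \<and> subseq (power_word m r) (zigzag_w m n)"
proof -
  have "zigzag_g m n = concat (map (power_word m) ([[cv, zv]] @ map (\<lambda>i. [gv i, cv]) [0..<n] @
      map (\<lambda>i. [wv, gv i]) (rev [0..<n]) @ [[zv, wv], [cv, zv]]))"
    by (simp add: zigzag_g_def comp_def)
  then have g: "subseq (power_word m r) (zigzag_g m n)"
    if "r \<in> {[cv, zv], [zv, wv]} \<union> (\<lambda>i. [gv i, cv]) ` {..<n} \<union> (\<lambda>i. [wv, gv i]) ` {..<n}" for r
    using that by (simp only:) (rule subseq_concat_member, auto)
  have "zigzag_w m n = concat (map (power_word m) ([[cv, zv], [wv, zv]] @ map (\<lambda>i. [gv i, wv]) [0..<n] @
      map (\<lambda>i. [cv, gv i]) (rev [0..<n]) @ [[cv, zv]]))"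
    by (simp add: zigzag_w_def comp_def)
  then have w: "subseq (power_word m r) (zigzag_w m n)"
    if "r \<in> {[cv, zv], [wv, zv]} \<union> (\<lambda>i. [gv i, wv]) ` {..<n} \<union> (\<lambda>i. [cv, gv i]) ` {..<n}" for r
    using that by (simp only:) (rule subseq_concat_member, auto)
  consider "x = cv" "y = zv" | "x = wv" "y = zv" | i where "i < n" "x = cv" "y = gv i"
    | i where "i < n" "x = wv" "y = gv i"
    using assms by auto
  then have "(\<exists>r. set r = {x, y} \<and> subseq (power_word m r) (zigzag_g m n)) \<and>
      (\<exists>r. set r = {x, y} \<and> subseq (power_word m r) (zigzag_w m n))"
  proof cases
    case 1
    then show ?thesis
      using g[of "[cv, zv]"] w[of "[cv, zv]"] by (intro conjI exI[of _ "[cv, zv]"]) auto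
  next
    case 2
    then show ?thesis
      using g[of "[zv, wv]"] w[of "[wv, zv]"]
      by (intro conjI exI[of _ "[zv, wv]"] exI[of _ "[wv, zv]"]) auto
  next
    case 3
    then show ?thesis
      using g[of "[gv i, cv]"] w[of "[cv, gv i]"]
      by (intro conjI exI[of _ "[gv i, cv]"] exI[of _ "[cv, gv i]"]) auto
  next
    case 4
    then show ?thesis
      using g[of "[wv, gv i]"] w[of "[gv i, wv]"]
      by (intro conjI exI[of _ "[wv, gv i]"] exI[of _ "[gv i, wv]"]) auto
  qed
  then show "\<exists>r. set r = {x, y} \<and> subseq (power_word m r) (zigzag_g m n)"
    and "\<exists>r. set r = {x, y} \<and> subseq (power_word m r) (zigzag_w m n)"
    by blast+
qed

lemma killed_subseq_power_word:
  assumes "subseq (power_word (Suc l) r) u" "{gen.a, gen.b} \<subseteq> (\<Union>x\<in>set r. set (\<psi> x))"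
  shows "killed l (concat (map \<psi> u))"
proof -
  have "killed l (power_word (Suc l) (concat (map \<psi> r)))"
    by (rule killed_power_word) (use assms(2) in auto)
  then show ?thesis
    using subseq_concat_map[OF assms(1), of \<psi>] unfolding killed_def concat_map_power_word
    by (rule subseq_order.trans)
qed

text \<open>If some variable of \<open>{c, w}\<close> and some variable of \<open>{z, g\<^sub>i}\<close> together involve both generators, both values are
zero because these two variables alternate. Otherwise, as every variable of one side is
paired with every variable of the other, either one side is sent to \<open>1\<close> or all values are powers
of one generator.\<close>

lemma zigzag_identity:
  assumes "0 < l"
  shows "m_satisfies (L1 l) (zigzag_g (Suc l) n) (zigzag_w (Suc l) n)"
  unfolding m_satisfies_L1_iff[OF assms]
proof
  fix \<psi> :: "nat \<Rightarrow> gen list"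
  define h where "h u = concat (map \<psi> u)" for u
  have h_append: "h (u @ v) = h u @ h v" for u v by (simp add: h_def)
  have set_h: "set (h u) = (\<Union>x\<in>set u. set (\<psi> x))" for u by (simp add: h_def)
  define m where "m = Suc l"
  have "0 < m" by (simp add: m_def)
  let ?R = "insert zv (gv ` {..<n})"
  show "nf l (concat (map \<psi> (zigzag_g (Suc l) n))) = nf l (concat (map \<psi> (zigzag_w (Suc l) n)))"
  proof (cases "\<exists>x\<in>{cv, wv}. \<exists>y\<in>?R. {gen.a, gen.b} \<subseteq> set (\<psi> x) \<union> set (\<psi> y)")
    case True
    then obtain x y where xy: "x \<in> {cv, wv}" "y \<in> ?R" "{gen.a, gen.b} \<subseteq> set (\<psi> x) \<union> set (\<psi> y)"
      by blast
    obtain r r' where "set r = {x, y}" "subseq (power_word (Suc l) r) (zigzag_g (Suc l) n)"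
      "set r' = {x, y}" "subseq (power_word (Suc l) r') (zigzag_w (Suc l) n)"
      using zigzag_alternates[OF xy(1,2)] by metis
    with xy(3) show ?thesis
      unfolding nf_eq_iff by (auto intro!: killed_subseq_power_word)
  next
    case False
    then have single: "\<exists>t. set (\<psi> x) \<union> set (\<psi> y) \<subseteq> {t}" if "x \<in> {cv, wv}" "y \<in> ?R" for x y
      using that by (intro not_both_gens) blast
    consider (left) "\<forall>y\<in>?R. \<psi> y = []" | (right) "\<psi> cv = []" "\<psi> wv = []"
      | (both) x y where "x \<in> {cv, wv}" "y \<in> ?R" "\<psi> x \<noteq> []" "\<psi> y \<noteq> []"
      by blast
    then have "remdups_adj (h (zigzag_g m n)) = remdups_adj (h (zigzag_w m n))"
    proof cases
      case left
      let ?Pg = "power_word m [cv, zv] @ concat (map (\<lambda>i. power_word m [gv i, cv]) [0..<n])"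
      let ?Mg = "concat (map (\<lambda>i. power_word m [wv, gv i]) (rev [0..<n])) @ power_word m [zv, wv]"
      let ?Pw = "power_word m [cv, zv]"
      let ?Mw = "power_word m [wv, zv] @ concat (map (\<lambda>i. power_word m [gv i, wv]) [0..<n])"
      let ?Qw = "concat (map (\<lambda>i. power_word m [cv, gv i]) (rev [0..<n])) @ power_word m [cv, zv]"
      have "set (h ?Pg) = set (\<psi> cv)" "set (h ?Pw) = set (\<psi> cv)" "set (h ?Qw) = set (\<psi> cv)"
        "set (h ?Mg) = set (\<psi> wv)" "set (h ?Mw) = set (\<psi> wv)"
        using left \<open>0 < m\<close> by (auto simp: set_h)
      moreover obtain s t where "set (\<psi> cv) \<subseteq> {s}" "set (\<psi> wv) \<subseteq> {t}"
        using single[of cv zv] single[of wv zv] by auto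
      ultimately have "remdups_adj (h ?Pg) = remdups_adj (h ?Pw)"
          "remdups_adj (h ?Mg) = remdups_adj (h ?Mw)" "remdups_adj (h ?Pw) = remdups_adj (h ?Qw)"
        by (metis remdups_adj_single)+
      then have "remdups_adj (h ?Pg @ h ?Mg @ h ?Pw) = remdups_adj (h ?Pw @ h ?Mw @ h ?Qw)"
        by (intro remdups_adj_append_cong)
      then show ?thesis
        by (simp add: zigzag_g_def zigzag_w_def h_append)
    next
      case right
      let ?G = "h (concat (map (\<lambda>i. power_word m [gv i, cv]) [0..<n])) @
        h (concat (map (\<lambda>i. power_word m [wv, gv i]) (rev [0..<n])))"
      let ?C = "power_word m [cv, zv]"
      have "set (h (?C @ power_word m [wv, zv])) = set (\<psi> zv)"
        "set (h (power_word m [zv, wv] @ ?C)) = set (\<psi> zv)" "set (h ?C) = set (\<psi> zv)"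
        using right \<open>0 < m\<close> by (auto simp: set_h)
      moreover obtain t where "set (\<psi> zv) \<subseteq> {t}"
        using single[of cv zv] by auto
      ultimately have "remdups_adj (h ?C) = remdups_adj (h (?C @ power_word m [wv, zv]))"
          "remdups_adj (h (power_word m [zv, wv] @ ?C)) = remdups_adj (h ?C)"
        by (metis remdups_adj_single)+
      then have "remdups_adj (h ?C @ ?G @ h (power_word m [zv, wv] @ ?C)) =
          remdups_adj (h (?C @ power_word m [wv, zv]) @ ?G @ h ?C)"
        by (intro remdups_adj_append_cong) simp_all
      moreover have "h (concat (map (\<lambda>i. power_word m [gv i, cv]) [0..<n])) =
          h (concat (map (\<lambda>i. power_word m [gv i, wv]) [0..<n]))"
        "h (concat (map (\<lambda>i. power_word m [wv, gv i]) (rev [0..<n]))) =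
          h (concat (map (\<lambda>i. power_word m [cv, gv i]) (rev [0..<n])))"
        using right by (simp_all add: h_def map_concat concat_map_power_word comp_def)
      ultimately show ?thesis
        by (simp add: zigzag_g_def zigzag_w_def h_append)
    next
      case both
      obtain t where t: "set (\<psi> x) \<union> set (\<psi> y) \<subseteq> {t}" using single[OF both(1,2)] by blast
      have R: "set (\<psi> y') \<subseteq> {t}" if y': "y' \<in> ?R" for y'
      proof -
        obtain t' where "set (\<psi> x) \<union> set (\<psi> y') \<subseteq> {t'}" using single[OF both(1) y'] by blast
        moreover have "t \<in> set (\<psi> x)" using t both by (cases "\<psi> x") auto
        ultimately show ?thesis by blast
      qed
      have L: "set (\<psi> x') \<subseteq> {t}" if x': "x' \<in> {cv, wv}" for x'
      proof -
        obtain t' where "set (\<psi> x') \<union> set (\<psi> y) \<subseteq> {t'}" using single[OF x' both(2)] by blast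
        moreover have "t \<in> set (\<psi> y)" using t both by (cases "\<psi> y") auto
        ultimately show ?thesis by blast
      qed
      have "set (zigzag_g m n) = {cv, wv} \<union> ?R" "set (zigzag_w m n) = {cv, wv} \<union> ?R"
        using \<open>0 < m\<close> by (auto simp: zigzag_g_def zigzag_w_def)
      moreover have "(\<Union>x\<in>{cv, wv} \<union> ?R. set (\<psi> x)) \<subseteq> {t}"
        using L R by blast
      ultimately show ?thesis
        by (intro remdups_adj_single[of _ t]) (simp_all only: set_h)
    qed
    then show ?thesis unfolding nf_eq_iff m_def h_def by blast
  qed
qed

section \<open>Rigidity\<close>


lemma subseq_power_word_pair:
  assumes "2 \<le> m"
  shows "subseq [x, y, x] (power_word m [x, y])" "subseq [y, x, y] (power_word m [x, y])"
proof -
  obtain k where "m = Suc (Suc k)"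
    using assms by (metis Suc_diff_Suc Suc_le_lessD add_2_eq_Suc le_add_diff_inverse)
  then show "subseq [x, y, x] (power_word m [x, y])" "subseq [y, x, y] (power_word m [x, y])"
    by auto
qed

lemma zigzag_enclosed:
  assumes "2 \<le> m"
  shows "enclosed {zv} {wv} (zigzag_g m n)"
    and "j < n \<Longrightarrow> enclosed {cv} {gv j} (zigzag_g m n)"
    and "\<not> enclosed {cv} {wv} (zigzag_g m n)"
    and "\<not> enclosed {zv} (gv ` {..<n}) (zigzag_g m n)"
    and "i < j \<Longrightarrow> j < n \<Longrightarrow> \<not> enclosed {gv i} {gv j} (zigzag_g m n)"
proof -
  have "subseq [wv, zv, wv] (zigzag_g m n)"
    unfolding zigzag_g_def using subseq_power_word_pair(2)[OF assms, of wv zv] by blast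
  then show "enclosed {zv} {wv} (zigzag_g m n)" by (simp add: enclosed_def)
  show "enclosed {cv} {gv j} (zigzag_g m n)" if "j < n"
  proof -
    have "subseq (power_word m [gv j, cv]) (concat (map (\<lambda>i. power_word m [gv i, cv]) [0..<n]))"
      using that by (intro subseq_concat_member) auto
    then have "subseq [gv j, cv, gv j] (concat (map (\<lambda>i. power_word m [gv i, cv]) [0..<n]))"
      by (rule subseq_order.trans[OF subseq_power_word_pair(1)[OF assms]])
    then have "subseq [gv j, cv, gv j] (zigzag_g m n)"
      unfolding zigzag_g_def by blast
    then show ?thesis by (simp add: enclosed_def)
  qed
  show "\<not> enclosed {cv} {wv} (zigzag_g m n)"
    by (rule not_enclosed[of _ "power_word m [cv, zv] @ concat (map (\<lambda>i. power_word m [gv i, cv]) [0..<n])"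
      "concat (map (\<lambda>i. power_word m [wv, gv i]) (rev [0..<n])) @ power_word m [zv, wv]"
      "power_word m [cv, zv]"]) (auto simp: zigzag_g_def)
  show "\<not> enclosed {zv} (gv ` {..<n}) (zigzag_g m n)"
    by (rule not_enclosed[of _ "power_word m [cv, zv]"
      "concat (map (\<lambda>i. power_word m [gv i, cv]) [0..<n]) @
       concat (map (\<lambda>i. power_word m [wv, gv i]) (rev [0..<n]))"
      "power_word m [zv, wv] @ power_word m [cv, zv]"]) (auto simp: zigzag_g_def)
  show "\<not> enclosed {gv i} {gv j} (zigzag_g m n)" if "i < j" "j < n"
  proof -
    have "[0..<n] = [0..<j] @ [j..<n]"
      using that upt_add_eq_append[of 0 j "n - j"] by simp
    then show ?thesis
      using that
      by (intro not_enclosed[of _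
        "power_word m [cv, zv] @ concat (map (\<lambda>i. power_word m [gv i, cv]) [0..<j])"
        "concat (map (\<lambda>i. power_word m [gv i, cv]) [j..<n]) @
         concat (map (\<lambda>i. power_word m [wv, gv i]) (rev [j..<n]))"
        "concat (map (\<lambda>i. power_word m [wv, gv i]) (rev [0..<j])) @
         power_word m [zv, wv] @ power_word m [cv, zv]"]) (auto simp: zigzag_g_def)
  qed
qed

text \<open>If \<open>y\<close> is absent, this only says that \<open>x\<close> occurs.\<close>

definition first_before :: "nat \<Rightarrow> nat \<Rightarrow> word \<Rightarrow> bool" where
  "first_before x y u \<longleftrightarrow> x \<in> set (takeWhile (\<lambda>v. v \<noteq> y) u)"

lemma first_before_append:
  "first_before x y (p @ q) \<longleftrightarrow>
    (if y \<in> set p then first_before x y p else x \<in> set p \<or> first_before x y q)"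
  by (auto simp: first_before_def takeWhile_append)

lemma first_before_in_set: "first_before x y u \<Longrightarrow> x \<in> set u"
  by (auto simp: first_before_def dest: set_takeWhileD)

lemma first_before_split:
  "y \<notin> set p \<Longrightarrow> first_before x y (p @ y # q) \<longleftrightarrow> x \<in> set p"
  by (simp add: first_before_append) (simp add: first_before_def)

lemma zigzag_order:
  assumes "0 < m" "i < n"
  shows "first_before (gv i) wv (zigzag_g m n)" and "\<not> first_before (gv i) wv (zigzag_w m n)"
proof -
  show "first_before (gv i) wv (zigzag_g m n)"
    using assms by (auto simp: zigzag_g_def first_before_append)
  show "\<not> first_before (gv i) wv (zigzag_w m n)"
    using assms
    by (auto simp: zigzag_w_def first_before_append split: if_splits dest: first_before_in_set)
qed

text \<open>Suppose \<open>g\<^sub>i\<close> starts before \<open>w\<close> and \<open>g\<^sub>j\<close> after it. Some \<open>z\<close> lies within the span of \<open>w\<close>. It comes after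
the start of \<open>g\<^sub>i\<close> and cannot be enclosed by the \<open>g\<close>'s, so all of \<open>g\<^sub>j\<close> lies between the start of \<open>w\<close> and
this \<open>z\<close>, hence within the span of \<open>w\<close>. The letter \<open>c\<close> enclosed by \<open>g\<^sub>j\<close> is then enclosed by
\<open>w\<close>, which is impossible.\<close>

lemma zigzag_rigid:
  assumes m: "2 \<le> m" and eq: "m_satisfies (L1 3) (zigzag_g m n) u"
    and "i < n" "j < n" and "first_before (gv i) wv u"
  shows "first_before (gv j) wv u"
proof (rule ccontr)
  assume not_before: "\<not> first_before (gv j) wv u"
  note enclosed = zigzag_enclosed[OF m, where n = n]
  have zw: "enclosed {zv} {wv} u" and cg: "enclosed {cv} {gv j} u"
    and cw: "\<not> enclosed {cv} {wv} u" and zg: "\<not> enclosed {zv} (gv ` {..<n}) u"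
    using enclosed(1) enclosed(2)[OF \<open>j < n\<close>] enclosed(3,4)
    by (subst L3_enclosed[OF eq, symmetric]; auto)+
  have "wv \<in> set u" using zw set_subseq by (fastforce simp: enclosed_def)
  then obtain p q where u: "u = p @ wv # q" "wv \<notin> set p" by (meson split_list_first)
  have gi: "gv i \<in> set p"
    using assms(5) u by (simp add: first_before_split)
  have gj: "gv j \<notin> set p"
    using not_before u by (simp add: first_before_split)
  have zwq: "subseq [zv, wv] q"
  proof -
    have "subseq [wv, zv, wv] (p @ wv # q)" using zw u by (simp add: enclosed_def)
    then show ?thesis using u(2) by (induction p) (auto split: if_splits)
  qed
  have cgq: "subseq [gv j, cv, gv j] q"
  proof -
    have "subseq [gv j, cv, gv j] (p @ wv # q)" using cg u by (simp add: enclosed_def)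
    then show ?thesis using gj by (induction p) (auto split: if_splits)
  qed
  obtain q1 q2 where q: "q = q1 @ zv # q2" "wv \<in> set q2"
    using zwq by (auto dest!: list_emb_ConsD simp: subseq_singleton_left)
  have "gv j \<notin> set q2"
  proof
    assume "gv j \<in> set q2"
    then have "subseq [gv i, zv, gv j] u"
      unfolding subseq_three_iff using gi u(1) q(1)
      by (intro exI[of _ "p @ wv # q1"] exI[of _ q2]) simp
    with zg \<open>i < n\<close> \<open>j < n\<close> show False by (auto simp: enclosed_def)
  qed
  then have "cv \<in> set q1"
    using cgq unfolding subseq_three_iff q
    by (auto simp: append_eq_append_conv2 append_eq_Cons_conv Cons_eq_append_conv)
  then obtain r s where "q1 = r @ cv # s" by (meson split_list)
  then have "subseq [wv, cv, wv] u"
    unfolding subseq_three_iff using u(1) q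
    by (intro exI[of _ "p @ wv # r"] exI[of _ "s @ zv # q2"]) simp
  with cw show False by (simp add: enclosed_def)
qed


section \<open>Identities in few variables\<close>


lemma set_subst: "set (subst \<theta> u) = (\<Union>x\<in>set u. set (\<theta> x))"
  by (simp add: subst_def)

lemma subst_append: "subst \<theta> (u @ v) = subst \<theta> u @ subst \<theta> v"
  by (simp add: subst_def)

lemma subst_Cons: "subst \<theta> (x # u) = \<theta> x @ subst \<theta> u"
  by (simp add: subst_def)

text \<open>A second copy of \<open>\<theta> x\<close> would produce \<open>g\<^sub>j \<dots> g\<^sub>i \<dots> g\<^sub>j\<close>, contrary to the nesting of \<open>g\<^sub>j\<close> inside \<open>g\<^sub>i\<close>.\<close>

lemma zigzag_shared_letter_linear:
  assumes m: "2 \<le> m" and eq: "m_satisfies (L1 3) (zigzag_g m n) (p @ subst \<theta> s @ q)"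
    and "i < j" "j < n" "gv i \<in> set (\<theta> x)" "gv j \<in> set (\<theta> x)"
  shows "count_list s x \<le> 1"
proof (rule ccontr)
  assume not_linear: "\<not> count_list s x \<le> 1"
  then have "x \<in> set s" using count_list_0_iff[of s x] by fastforce
  then obtain s1 s2 where s: "s = s1 @ x # s2" "x \<notin> set s1" by (meson split_list_first)
  with not_linear have "x \<in> set s2" by (cases "x \<in> set s2") (simp_all add: count_list_0_iff)
  then obtain s3 s4 where "s2 = s3 @ x # s4" by (meson split_list)
  with s have w: "p @ subst \<theta> s @ q =
      (p @ subst \<theta> s1) @ \<theta> x @ subst \<theta> s3 @ \<theta> x @ (subst \<theta> s4 @ q)"
    by (simp add: subst_append subst_Cons)
  obtain r r' where r: "\<theta> x = r @ gv i # r'" using assms(5) by (meson split_list)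
  have "gv j \<in> set r \<or> gv j \<in> set r'" using assms(3,6) r by auto
  then have "subseq [gv j, gv i, gv j] (p @ subst \<theta> s @ q)"
  proof
    assume "gv j \<in> set r"
    then show ?thesis
      unfolding subseq_three_iff w
      by (intro exI[of _ "p @ subst \<theta> s1 @ r"] exI[of _ "r' @ subst \<theta> s3 @ \<theta> x @ subst \<theta> s4 @ q"])
        (simp add: r)
  next
    assume "gv j \<in> set r'"
    then show ?thesis
      unfolding subseq_three_iff w
      by (intro exI[of _ "p @ subst \<theta> s1 @ \<theta> x @ subst \<theta> s3 @ r"] exI[of _ "r' @ subst \<theta> s4 @ q"])
        (simp add: r)
  qed
  then have "enclosed {gv i} {gv j} (p @ subst \<theta> s @ q)"
    by (simp add: enclosed_def)
  moreover have "\<not> enclosed {gv i} {gv j} (p @ subst \<theta> s @ q)"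
    using zigzag_enclosed(5)[OF m assms(3,4)] L3_enclosed[OF eq, of "{gv j}" "{gv i}"] assms(3) by simp
  ultimately show False by blast
qed

lemma first_letter_containing:
  "a \<in> set (subst \<theta> s) \<Longrightarrow> \<exists>s1 x s2. s = s1 @ x # s2 \<and> a \<in> set (\<theta> x) \<and> a \<notin> set (subst \<theta> s1)"
proof (induction s)
  case (Cons y s)
  show ?case
  proof (cases "a \<in> set (\<theta> y)")
    case True
    then show ?thesis by (intro exI[of _ "[]"]) (auto simp: subst_def)
  next
    case False
    then obtain s1 x s2 where "s = s1 @ x # s2 \<and> a \<in> set (\<theta> x) \<and> a \<notin> set (subst \<theta> s1)"
      using Cons by (auto simp: subst_Cons)
    with False show ?thesis by (intro exI[of _ "y # s1"]) (auto simp: subst_Cons)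
  qed
qed (simp add: subst_def)

text \<open>If the order were reversed, rigidity would put every \<open>g\<^sub>i\<close> after the first \<open>w\<close> on the right-hand side. Then all
first occurrences of the \<open>g\<^sub>i\<close> lie inside \<open>\<theta> s\<close>, and there are too few variables to separate them. A linear
variable \<open>x\<close> whose image contains the first \<open>g\<^sub>i\<close> is preceded by the same variables on both sides,
and none of their images contains \<open>w\<close>; so \<open>g\<^sub>i\<close> still starts before \<open>w\<close>.\<close>

lemma short_identity_preserves_order:
  assumes m: "2 \<le> m" and st: "m_satisfies (L1 3) s t" and short: "card (set s) < n"
    and eq: "m_satisfies (L1 3) (zigzag_g m n) (p @ subst \<theta> s @ q)"
    and before: "\<forall>i<n. first_before (gv i) wv (p @ subst \<theta> s @ q)"
  shows "\<forall>i<n. first_before (gv i) wv (p @ subst \<theta> t @ q)"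
proof (rule ccontr)
  have eq': "m_satisfies (L1 3) (zigzag_g m n) (p @ subst \<theta> t @ q)"
    using m_satisfies_trans[OF eq m_satisfies_L1_subst[OF st]] by simp
  have st_set: "set (subst \<theta> s) = set (subst \<theta> t)"
    using L3_set_eq[OF st] by (simp add: set_subst)
  assume "\<not> (\<forall>i<n. first_before (gv i) wv (p @ subst \<theta> t @ q))"
  then have after: "\<not> first_before (gv i) wv (p @ subst \<theta> t @ q)" if "i < n" for i
    using zigzag_rigid[OF m eq' that] by blast
  have wp: "wv \<notin> set p"
    using before after[of 0] short by (auto simp: first_before_append split: if_splits)
  have gp: "gv i \<notin> set p" if "i < n" for i
    using after[OF that] wp by (simp add: first_before_append)
  have gs: "gv i \<in> set (subst \<theta> s)" if "i < n" for i
  proof (rule ccontr)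
    assume "gv i \<notin> set (subst \<theta> s)"
    then show False
      using before[rule_format, OF that] after[OF that] wp gp[OF that]
      by (auto simp: first_before_append st_set split: if_splits dest: first_before_in_set)
  qed
  have "\<forall>i. \<exists>x. i < n \<longrightarrow> (\<exists>s1 s2. s = s1 @ x # s2 \<and> gv i \<in> set (\<theta> x) \<and> gv i \<notin> set (subst \<theta> s1))"
    using first_letter_containing[OF gs] by blast
  then obtain f where f: "\<And>i. i < n \<Longrightarrow>
      \<exists>s1 s2. s = s1 @ f i # s2 \<and> gv i \<in> set (\<theta> (f i)) \<and> gv i \<notin> set (subst \<theta> s1)"
    by metis
  have "f ` {..<n} \<subseteq> set s" using f by fastforce
  then have "card (f ` {..<n}) < card {..<n}"
    using short card_mono[OF finite_set, of "f ` {..<n}" s] by simp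
  then have "\<not> inj_on f {..<n}" by (rule pigeonhole)
  then obtain i0 j0 where "i0 < n" "j0 < n" "i0 \<noteq> j0" "f i0 = f j0"
    unfolding inj_on_def by auto
  then obtain i j where ij: "i < j" "j < n" "f i = f j"
    by (metis nat_neq_iff)
  define x where "x = f i"
  have i: "i < n" using ij by simp
  obtain s1 s2 where s: "s = s1 @ x # s2" "gv i \<in> set (\<theta> x)" "gv i \<notin> set (subst \<theta> s1)"
    using f[OF i] unfolding x_def by blast
  have "gv j \<in> set (\<theta> x)" using f[OF ij(2)] ij(3) unfolding x_def by auto
  then have linear: "count_list s x \<le> 1"
    using zigzag_shared_letter_linear[OF m eq ij(1,2) s(2)] by blast
  then have "x \<notin> set s1" "x \<notin> set s2"
    using s(1) by (simp_all add: count_list_0_iff)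
  have "x \<in> set t" "count_list t x \<le> 1"
    using s(1) linear L3_linear[OF st, of x] L3_set_eq[OF st] by auto
  then obtain t1 t2 where t: "t = t1 @ x # t2" "x \<notin> set t1" "x \<notin> set t2"
    using count_list_le_1_split by metis
  have "set s1 = set t1"
    using L3_before_linear[OF st[unfolded s(1) t(1)]] \<open>x \<notin> set s1\<close> \<open>x \<notin> set s2\<close> t(2,3) by blast
  then have st1: "set (subst \<theta> s1) = set (subst \<theta> t1)" by (simp add: set_subst)
  have bs: "first_before (gv i) wv (p @ subst \<theta> s1 @ \<theta> x @ subst \<theta> s2 @ q)"
    using before i by (simp add: s(1) subst_append subst_Cons)
  have ws1: "wv \<notin> set (subst \<theta> s1)"
    using bs wp gp[OF i] s(3)
    by (auto simp: first_before_append split: if_splits dest: first_before_in_set)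
  have "first_before (gv i) wv (\<theta> x @ subst \<theta> s2 @ q)"
    using bs wp gp[OF i] s(3) ws1 by (simp add: first_before_append)
  then have "first_before (gv i) wv (\<theta> x @ subst \<theta> t2 @ q)"
    using s(2) by (auto simp: first_before_append split: if_splits)
  then have "first_before (gv i) wv (p @ subst \<theta> t1 @ \<theta> x @ subst \<theta> t2 @ q)"
    using wp ws1 st1
    by (simp add: first_before_append[where p = p] first_before_append[where p = "subst \<theta> t1"])
  then show False
    using after[OF i] by (simp add: t(1) subst_append subst_Cons)
qed

text \<open>The context \<open>p, q\<close> and the substitution \<open>\<theta>\<close> are quantified so that the claim is inductive under the
congruence and instantiation rules.\<close>

lemma deducible_preserves_order:
  assumes m: "2 \<le> m" and \<Sigma>: "\<And>s t. (s, t) \<in> \<Sigma> \<Longrightarrow> m_satisfies (L1 3) s t \<and> card (set s) < n"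
    and "deducible \<Sigma> u v"
  defines "P \<equiv> \<lambda>w. m_satisfies (L1 3) (zigzag_g m n) w \<and> (\<forall>i<n. first_before (gv i) wv w)"
  shows "P (p @ subst \<theta> u @ q) \<longleftrightarrow> P (p @ subst \<theta> v @ q)"
  using assms(3)
proof (induction arbitrary: p \<theta> q)
  case (hyp s t)
  have st: "m_satisfies (L1 3) s t" "card (set s) < n" using \<Sigma>[OF hyp] by blast+
  then have ts: "m_satisfies (L1 3) t s" "card (set t) < n"
    using m_satisfies_sym L3_set_eq by metis+
  have "m_satisfies (L1 3) (zigzag_g m n) (p @ subst \<theta> s @ q)
      \<longleftrightarrow> m_satisfies (L1 3) (zigzag_g m n) (p @ subst \<theta> t @ q)"
    using m_satisfies_trans m_satisfies_L1_subst[OF st(1)] m_satisfies_L1_subst[OF ts(1)]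
    by (metis zero_less_numeral)
  then show ?case
    unfolding P_def
    using short_identity_preserves_order[OF m st] short_identity_preserves_order[OF m ts] by blast
next
  case (cong u v u' v')
  have "P (p @ subst \<theta> (u @ u') @ q) \<longleftrightarrow> P (p @ subst \<theta> u @ (subst \<theta> u' @ q))"
    by (simp add: subst_append)
  also have "\<dots> \<longleftrightarrow> P ((p @ subst \<theta> v) @ subst \<theta> u' @ q)"
    using cong.IH(1)[of p \<theta> "subst \<theta> u' @ q"] by simp
  also have "\<dots> \<longleftrightarrow> P ((p @ subst \<theta> v) @ subst \<theta> v' @ q)"
    by (rule cong.IH(2))
  finally show ?case by (simp add: subst_append)
next
  case (inst u v \<theta>')
  have "subst \<theta> (subst \<theta>' w) = subst (\<lambda>x. subst \<theta> (\<theta>' x)) w" for w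
    by (induction w) (simp_all add: subst_def)
  then show ?case using inst.IH by simp
qed blast+


theorem L1_not_finitely_based:
  assumes "3 \<le> l"
  shows "\<not> finitely_based (semigroup_of (L1 l))"
proof
  assume "finitely_based (semigroup_of (L1 l))"
  then obtain \<Sigma> where \<Sigma>: "finite \<Sigma>" "\<Sigma> \<subseteq> sg_identities (semigroup_of (L1 l))"
    "\<And>u v. (u, v) \<in> sg_identities (semigroup_of (L1 l)) \<Longrightarrow> deducible \<Sigma> u v"
    unfolding finitely_based_def by blast
  have "0 < l" using assms by simp
  note ids = free_monoid_image.sg_identities_iff[OF L1_image[OF this]]
  \<comment> \<open>This exceeds the number of variables of every identity in the basis.\<close>
  define n where "n = Suc (\<Sum>(s, t)\<in>\<Sigma>. card (set s))"
  let ?g = "zigzag_g (Suc l) n" and ?w = "zigzag_w (Suc l) n"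
  have "?g \<noteq> []" "?w \<noteq> []" by (simp_all add: zigzag_g_def zigzag_w_def)
  then have "deducible \<Sigma> ?g ?w"
    using \<Sigma>(3) ids zigzag_identity[OF \<open>0 < l\<close>] by blast
  moreover have "m_satisfies (L1 3) s t \<and> card (set s) < n" if "(s, t) \<in> \<Sigma>" for s t
  proof
    show "m_satisfies (L1 3) s t"
      using that \<Sigma>(2) ids m_satisfies_L1_mono[OF _ _ assms] by auto
    have "card (set s) \<le> (\<Sum>(s, t)\<in>\<Sigma>. card (set s))"
      using member_le_sum[OF that, of "\<lambda>(s, t). card (set s)"] \<Sigma>(1) by auto
    then show "card (set s) < n" by (simp add: n_def)
  qed
  moreover have subst_id: "subst (\<lambda>x. [x]) u = u" for u
    by (simp add: subst_def)
  ultimately have transfer: "m_satisfies (L1 3) ?g ?g \<and> (\<forall>i<n. first_before (gv i) wv ?g) \<longleftrightarrow>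
      m_satisfies (L1 3) ?g ?w \<and> (\<forall>i<n. first_before (gv i) wv ?w)"
    using deducible_preserves_order[of "Suc l" \<Sigma> n ?g ?w "[]" "\<lambda>x. [x]" "[]"] assms by simp
  moreover have "m_satisfies (L1 3) ?g ?g" by (simp add: m_satisfies_def)
  ultimately show False
    using zigzag_order[of "Suc l" _ n] by (auto simp: n_def)
qed

section \<open>Isoterms are words with boundedly many occurrences of each letter\<close>

definition bounded_words :: "nat \<Rightarrow> word set" where
  "bounded_words k = {u. \<forall>x. count_list u x \<le> k}"

lemma subseq_replicate_count: "n \<le> count_list u x \<Longrightarrow> subseq (replicate n x) u"
proof (induction u arbitrary: n)
  case (Cons y u)
  show ?case
  proof (cases "x = y")
    case True
    then show ?thesis using Cons by (cases n) auto
  next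
    case False
    then have "subseq (replicate n x) u" using Cons by simp
    then show ?thesis by (rule list_emb_Cons)
  qed
qed simp

lemma killed_repeated:
  assumes "k < count_list u x" "{gen.a, gen.b} \<subseteq> set (\<psi> x)" "l \<le> Suc (2 * k)"
  shows "killed l (concat (map \<psi> u))"
proof -
  have "subseq (replicate (Suc k) x) u"
    using assms(1) by (intro subseq_replicate_count) simp
  from subseq_concat_map[OF this, of \<psi>]
  have "subseq (power_word (Suc k) (\<psi> x)) (concat (map \<psi> u))" by (simp only: map_replicate)
  with killed_power_word[OF assms(2,3)] show ?thesis
    unfolding killed_def by (rule subseq_order.trans)
qed

lemma count_list_subseq: "subseq u v \<Longrightarrow> count_list u x \<le> count_list v x"
  by (induction rule: list_emb.induct) auto

lemma count_alternating: "count_list (alternating (Suc (2 * k))) gen.a = Suc k"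
proof -
  have "count_list (power_word k [gen.a, gen.b]) gen.a = k" by (induction k) auto
  then show ?thesis unfolding alternating_odd by simp
qed

lemma not_killed_if_count: "count_list w gen.a \<le> k \<Longrightarrow> \<not> killed (Suc (2 * k)) w"
  using count_list_subseq[of _ w gen.a] count_alternating[of k] unfolding killed_def
  by (metis Suc_n_not_le_n le_trans)

lemma remdups_adj_alternating: "remdups_adj (alternating l) = alternating l"
  using distinct_adj_alternating distinct_adj_altdef by metis

lemma alternating_even: "alternating (2 * k) = power_word k [gen.a, gen.b]"
  using alternating_odd[of k] by (simp add: alternating_Suc)

text \<open>The bound two is sharp: \<open>aabab\<close> and \<open>abaab\<close>, with three occurrences of \<open>a\<close>, contract to the same word.
The words in question have length at most four and are compared one by one.\<close>

lemma gen_words_eq: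
  fixes r s :: "gen list"
  assumes "remdups_adj r = remdups_adj s" "\<And>x. count_list r x = count_list s x" "\<And>x. count_list r x \<le> 2"
  shows "r = s"
proof -
  define W where "W = concat (map (\<lambda>n. List.n_lists n [gen.a, gen.b]) [0..<5])"
  have len: "length w = count_list w gen.a + count_list w gen.b" for w
  proof (induction w)
    case (Cons x w)
    then show ?case by (cases x) auto
  qed simp
  have "set w \<subseteq> {gen.a, gen.b}" for w using gen.exhaust by blast
  then have W: "w \<in> set W" if "count_list w gen.a \<le> 2" "count_list w gen.b \<le> 2" for w
    using that by (auto simp: W_def set_n_lists len)
  have "r \<in> set W" "s \<in> set W" using W assms(2,3) by metis+
  moreover have "\<forall>r\<in>set W. \<forall>s\<in>set W. remdups_adj r = remdups_adj s \<longrightarrow>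
      count_list r gen.a = count_list s gen.a \<longrightarrow> count_list r gen.b = count_list s gen.b \<longrightarrow>
      count_list r gen.a \<le> 2 \<longrightarrow> count_list r gen.b \<le> 2 \<longrightarrow> r = s"
    unfolding W_def by code_simp
  ultimately show ?thesis using assms by blast
qed

lemma eq_if_pair_filters_eq:
  "(\<And>x y. filter (\<lambda>z. z = x \<or> z = y) u = filter (\<lambda>z. z = x \<or> z = y) v) \<Longrightarrow> u = v"
proof (induction u arbitrary: v)
  case Nil
  show ?case
  proof (cases v)
    case (Cons y v')
    then show ?thesis using Nil[of y y] by simp
  qed simp
next
  case (Cons x u)
  have "v \<noteq> []" using Cons.prems[of x x] by auto
  then obtain y v' where v: "v = y # v'" by (cases v) auto
  have "y = x"
    using Cons.prems[of x y] v by simp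
  have "filter (\<lambda>z. z = x' \<or> z = y') u = filter (\<lambda>z. z = x' \<or> z = y') v'" for x' y'
    using Cons.prems[of x' y'] v \<open>y = x\<close> by (auto split: if_splits)
  then show ?case using Cons.IH v \<open>y = x\<close> by blast
qed

text \<open>The occurrences of a variable are counted by sending it to \<open>ab\<close>. The relative order of the
occurrences of \<open>x\<close> and \<open>y\<close> is seen by sending them to \<open>a\<close> and \<open>b\<close>; the value is nonzero because
\<open>a\<close> occurs \<open>k + 1\<close> times in the alternating word of length \<open>2k + 1\<close>.\<close>

lemma bounded_word_isoterm:
  assumes "u \<in> bounded_words k" "k \<le> 2" "m_satisfies (L1 (Suc (2 * k))) u v"
  shows "u = v"
proof (rule eq_if_pair_filters_eq)
  let ?l = "Suc (2 * k)"
  have bound: "count_list u x \<le> k" for x using assms(1) by (simp add: bounded_words_def)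
  have nf: "nf ?l (concat (map \<psi> u)) = nf ?l (concat (map \<psi> v))" for \<psi>
    using assms(3) by (simp add: m_satisfies_L1_iff)
  have remdups: "remdups_adj (concat (map \<psi> u)) = remdups_adj (concat (map \<psi> v))"
    if "count_list (concat (map \<psi> u)) gen.a \<le> k" for \<psi>
    using nf[of \<psi>] not_killed_if_count[OF that] unfolding nf_eq_iff by blast
  have counts: "count_list u x = count_list v x" for x
  proof -
    let ?\<psi> = "\<lambda>y. if y = x then [gen.a, gen.b] else []"
    have "count_list (power_word n [gen.a, gen.b]) gen.a = n" for n by (induction n) auto
    then have "remdups_adj (concat (map ?\<psi> u)) = remdups_adj (concat (map ?\<psi> v))"
      using bound by (intro remdups) (simp add: concat_map_single)
    then have "length (alternating (2 * count_list u x)) = length (alternating (2 * count_list v x))"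
      unfolding concat_map_single
      by (metis alternating_even remdups_adj_alternating)
    then show ?thesis by simp
  qed
  fix x y
  show "filter (\<lambda>z. z = x \<or> z = y) u = filter (\<lambda>z. z = x \<or> z = y) v"
  proof (cases "x = y")
    case True
    have "filter (\<lambda>z. z = x \<or> z = y) w = replicate (count_list w x) x" for w
      using True by (induction w) auto
    then show ?thesis using counts by simp
  next
    case False
    let ?\<tau> = "\<lambda>z. if z = x then gen.a else gen.b"
    let ?\<psi> = "\<lambda>z. if z = x then [gen.a] else if z = y then [gen.b] else []"
    let ?F = "\<lambda>w. filter (\<lambda>z. z = x \<or> z = y) w"
    have image: "concat (map ?\<psi> w) = map ?\<tau> (?F w)" for w
      using False by (induction w) auto
    have count_a: "count_list (map ?\<tau> (?F w)) gen.a = count_list w x"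
      and count_b: "count_list (map ?\<tau> (?F w)) gen.b = count_list w y" for w
      using False by (induction w) auto
    have "remdups_adj (map ?\<tau> (?F u)) = remdups_adj (map ?\<tau> (?F v))"
      using remdups[of ?\<psi>] bound unfolding image count_a by simp
    then have "map ?\<tau> (?F u) = map ?\<tau> (?F v)"
    proof (rule gen_words_eq)
      fix t
      show "count_list (map ?\<tau> (?F u)) t = count_list (map ?\<tau> (?F v)) t"
        by (cases t) (simp_all only: count_a count_b counts)
      show "count_list (map ?\<tau> (?F u)) t \<le> 2"
        using bound[of x] bound[of y] assms(2) by (cases t) (simp_all only: count_a count_b)
    qed
    moreover have "inj_on ?\<tau> (set (?F u) \<union> set (?F v))"
      using False by (auto simp: inj_on_def)
    ultimately show ?thesis by (simp add: inj_on_map_eq_map)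
  qed
qed

text \<open>Doubling one occurrence of a letter with more than \<open>k\<close> occurrences changes no value: a power of a
generator may be doubled, and for any other image both values are zero.\<close>

lemma isoterm_bounded:
  assumes "u \<in> Isot (L1 (Suc (2 * k)))"
  shows "u \<in> bounded_words k"
proof (rule ccontr)
  let ?l = "Suc (2 * k)"
  assume "u \<notin> bounded_words k"
  then obtain x where x: "k < count_list u x" by (auto simp: bounded_words_def not_le)
  then have "x \<in> set u" using count_list_0_iff[of u x] by fastforce
  then obtain p q where u: "u = p @ x # q" by (meson split_list)
  have "nf ?l (concat (map \<psi> u)) = nf ?l (concat (map \<psi> (p @ x # x # q)))" for \<psi>
  proof (cases "{gen.a, gen.b} \<subseteq> set (\<psi> x)")
    case True
    moreover have "k < count_list (p @ x # x # q) x" using x u by simp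
    ultimately show ?thesis
      unfolding nf_eq_iff using x by (intro disjI1 conjI killed_repeated) auto
  next
    case False
    then obtain t where "set (\<psi> x) \<subseteq> {t}" using not_both_gens by metis
    then have "remdups_adj (\<psi> x) = remdups_adj (\<psi> x @ \<psi> x)"
      by (rule remdups_adj_single) simp
    then have "remdups_adj (concat (map \<psi> p) @ \<psi> x @ concat (map \<psi> q)) =
        remdups_adj (concat (map \<psi> p) @ (\<psi> x @ \<psi> x) @ concat (map \<psi> q))"
      by (intro remdups_adj_append_cong) simp_all
    then show ?thesis unfolding nf_eq_iff u by simp
  qed
  then have "m_satisfies (L1 ?l) u (p @ x # x # q)" by (simp add: m_satisfies_L1_iff)
  then have "u = p @ x # x # q" using assms by (simp add: Isot_def)
  with u show False by simp
qed

lemma Isot_L1: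
  assumes "k \<le> 2"
  shows "Isot (L1 (Suc (2 * k))) = bounded_words k"
  using isoterm_bounded bounded_word_isoterm[OF _ assms] by (auto simp: Isot_def)

section \<open>Identities of the Rees quotient by words with bounded occurrences\<close>

definition heavy :: "nat \<Rightarrow> word \<Rightarrow> nat set" where
  "heavy k u = {x. k < count_list u x}"

definition light_part :: "nat \<Rightarrow> word \<Rightarrow> word" where
  "light_part k u = filter (\<lambda>x. x \<notin> heavy k u) u"

definition bounded_congruence :: "nat \<Rightarrow> (word \<times> word) set" where
  "bounded_congruence k = {(u, v). u = v \<or> heavy k u \<noteq> {} \<and> heavy k v \<noteq> {}}"

lemma bounded_congruence_iff:
  "(u, v) \<in> bounded_congruence k \<longleftrightarrow> u = v \<or> heavy k u \<noteq> {} \<and> heavy k v \<noteq> {}"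
  by (simp add: bounded_congruence_def)

lemma S1_bounded_words:
  "S1 (bounded_words k) = m_quotient free_monoid (bounded_congruence k)"
proof -
  have "\<not> (\<exists>w \<in> bounded_words k. sublist u w) \<longleftrightarrow> heavy k u \<noteq> {}" for u
  proof
    assume "heavy k u \<noteq> {}"
    then obtain x where x: "k < count_list u x" by (auto simp: heavy_def)
    have "count_list u x \<le> k" if "w \<in> bounded_words k" "sublist u w" for w
      using count_list_subseq[OF sublist_imp_subseq[OF that(2)], of x] that(1)
      by (auto simp: bounded_words_def intro: le_trans)
    with x show "\<not> (\<exists>w \<in> bounded_words k. sublist u w)" by (meson not_le)
  next
    assume "\<not> (\<exists>w \<in> bounded_words k. sublist u w)"
    then have "u \<notin> bounded_words k" by blast
    then show "heavy k u \<noteq> {}" by (auto simp: bounded_words_def heavy_def not_le)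
  qed
  then have "rees_congruence free_monoid {u. \<not> (\<exists>w \<in> bounded_words k. sublist u w)} =
      bounded_congruence k"
    by (auto simp: rees_congruence_def free_monoid_def bounded_congruence_def)
  then show ?thesis by (simp add: S1_def)
qed

lemma heavy_append: "heavy k u \<union> heavy k v \<subseteq> heavy k (u @ v)"
  by (auto simp: heavy_def)

lemma S1_image:
  "free_monoid_image (S1 (bounded_words k)) (\<lambda>u. bounded_congruence k `` {u})"
proof
  have "sym (bounded_congruence k)" "trans (bounded_congruence k)"
    by (auto intro!: symI transI simp: bounded_congruence_iff)
  moreover have "(u @ v, u' @ v') \<in> bounded_congruence k"
    if "(u, u') \<in> bounded_congruence k" "(v, v') \<in> bounded_congruence k" for u u' v v'
    using that heavy_append[of k u v] heavy_append[of k u' v'] unfolding bounded_congruence_iff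
    by blast
  moreover have refl: "(u, u) \<in> bounded_congruence k" for u by (simp add: bounded_congruence_iff)
  ultimately have "class_mult (@) (bounded_congruence k) (bounded_congruence k `` {u})
      (bounded_congruence k `` {v}) = bounded_congruence k `` {u @ v}" for u v
    by (intro class_mult_class) auto
  then show "bounded_congruence k `` {u @ v} =
      bounded_congruence k `` {u} \<otimes>\<^bsub>S1 (bounded_words k)\<^esub> bounded_congruence k `` {v}" for u v
    by (simp add: S1_bounded_words m_quotient_def free_monoid_def)
  show "bounded_congruence k `` {[]} = \<one>\<^bsub>S1 (bounded_words k)\<^esub>"
    by (simp add: S1_bounded_words m_quotient_def free_monoid_def)
  show "range (\<lambda>u. bounded_congruence k `` {u}) = carrier (S1 (bounded_words k))"
    by (auto simp: S1_bounded_words m_quotient_def free_monoid_def quotient_def)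
qed

lemma S1_word_eq_iff:
  "bounded_congruence k `` {u} = bounded_congruence k `` {v} \<longleftrightarrow> (u, v) \<in> bounded_congruence k"
proof
  assume "bounded_congruence k `` {u} = bounded_congruence k `` {v}"
  moreover have "v \<in> bounded_congruence k `` {v}" by (simp add: bounded_congruence_iff)
  ultimately show "(u, v) \<in> bounded_congruence k" by blast
next
  have "bounded_congruence k `` {w} = {w. heavy k w \<noteq> {}}" if "heavy k w \<noteq> {}" for w
    using that by (auto simp: bounded_congruence_iff)
  then show "bounded_congruence k `` {u} = bounded_congruence k `` {v}"
    if "(u, v) \<in> bounded_congruence k"
    using that by (auto simp only: bounded_congruence_iff)
qed

lemma count_list_filter: "count_list (filter P u) x = (if P x then count_list u x else 0)"
  by (induction u) auto

lemma count_list_concat_map: "c \<in> set (\<psi> x) \<Longrightarrow> count_list u x \<le> count_list (concat (map \<psi> u)) c"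
proof (induction u)
  case (Cons y u)
  have "0 < count_list (\<psi> x) c" using Cons.prems count_list_0_iff[of "\<psi> x" c] by fastforce
  with Cons show ?case by auto
qed simp

text \<open>A heavy letter is zero unless it is sent to the empty word. So the identities say no more
than which letters are heavy and what remains when these are deleted.\<close>

lemma S1_identity_iff:
  "(u, v) \<in> sg_identities (semigroup_of (S1 (bounded_words k))) \<longleftrightarrow>
    u \<noteq> [] \<and> v \<noteq> [] \<and> heavy k u = heavy k v \<and> light_part k u = light_part k v"
proof -
  have "(\<forall>\<psi>. (concat (map \<psi> u), concat (map \<psi> v)) \<in> bounded_congruence k) \<longleftrightarrow>
      heavy k u = heavy k v \<and> light_part k u = light_part k v"
  proof
    assume *: "\<forall>\<psi>. (concat (map \<psi> u), concat (map \<psi> v)) \<in> bounded_congruence k"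
    have "concat (map (\<lambda>x. if P x then [x] else []) w) = filter P w" for P :: "nat \<Rightarrow> bool" and w
      by (induction w) auto
    with * have restrict: "(filter P u, filter P v) \<in> bounded_congruence k" for P
      by metis
    have "x \<in> heavy k u \<longleftrightarrow> x \<in> heavy k v" for x
    proof -
      have "heavy k (filter (\<lambda>z. z = x) w) = {z. z = x \<and> x \<in> heavy k w}" for w
        by (auto simp: heavy_def count_list_filter)
      then show ?thesis
        using restrict[of "\<lambda>z. z = x"] count_list_filter[of "\<lambda>z. z = x" _ x]
        unfolding bounded_congruence_iff by (auto simp: heavy_def) metis+
    qed
    then have heavy_eq: "heavy k u = heavy k v" by blast
    have "heavy k (light_part k u) = {}"
      by (auto simp: heavy_def light_part_def count_list_filter)
    then show "heavy k u = heavy k v \<and> light_part k u = light_part k v"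
      using heavy_eq restrict[of "\<lambda>x. x \<notin> heavy k u"]
      by (auto simp: bounded_congruence_iff light_part_def)
  next
    assume *: "heavy k u = heavy k v \<and> light_part k u = light_part k v"
    show "\<forall>\<psi>. (concat (map \<psi> u), concat (map \<psi> v)) \<in> bounded_congruence k"
    proof
      fix \<psi> :: "nat \<Rightarrow> word"
      show "(concat (map \<psi> u), concat (map \<psi> v)) \<in> bounded_congruence k"
      proof (cases "\<exists>x\<in>heavy k u. \<psi> x \<noteq> []")
        case True
        then obtain x c where "x \<in> heavy k u" "c \<in> set (\<psi> x)" by fastforce
        then have "c \<in> heavy k (concat (map \<psi> w))" if "heavy k w = heavy k u" for w
        proof -
          have "k < count_list w x" using that \<open>x \<in> heavy k u\<close> unfolding heavy_def by blast
          then show ?thesis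
            using count_list_concat_map[where \<psi> = \<psi> and x = x, OF \<open>c \<in> set (\<psi> x)\<close>, of w]
            by (simp add: heavy_def)
        qed
        with * show ?thesis unfolding bounded_congruence_iff by auto
      next
        case False
        have "concat (map \<psi> w) = concat (map \<psi> (light_part k w))" if "heavy k w = heavy k u" for w
        proof -
          have "concat (map \<psi> r) = concat (map \<psi> (filter (\<lambda>x. x \<notin> heavy k u) r))" for r
            using False by (induction r) auto
          then show ?thesis using that by (simp add: light_part_def)
        qed
        with * show ?thesis unfolding bounded_congruence_iff by metis
      qed
    qed
  qed
  then show ?thesis
    unfolding free_monoid_image.sg_identities_iff[OF S1_image]
      free_monoid_image.m_satisfies_iff[OF S1_image] S1_word_eq_iff by blast
qed

section \<open>A finite basis of the Rees quotient\<close>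

text \<open>All identities over the letters \<open>0, \<dots>, k + 1\<close> up to a length that accommodates the
identities used in \<open>collect_occurrences\<close>, where the letter \<open>0\<close> occurs \<open>k + 1\<close> or \<open>k + 2\<close> times among at most
\<open>k + 1\<close> others.\<close>

definition bounded_basis :: "nat \<Rightarrow> (word \<times> word) set" where
  "bounded_basis k = {(u, v) \<in> sg_identities (semigroup_of (S1 (bounded_words k))).
     set u \<union> set v \<subseteq> {..k + 1} \<and> length u \<le> 3 * k + 3 \<and> length v \<le> 3 * k + 3}"

lemma finite_bounded_basis: "finite (bounded_basis k)"
proof (rule finite_subset)
  let ?W = "{u. set u \<subseteq> {..k + 1} \<and> length u \<le> 3 * k + 3}"
  show "bounded_basis k \<subseteq> ?W \<times> ?W" by (auto simp: bounded_basis_def)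
  show "finite (?W \<times> ?W)" by (intro finite_cartesian_product finite_lists_length_le) simp_all
qed

lemma bounded_basis_instance:
  assumes "u \<noteq> []" "v \<noteq> []" "heavy k u = heavy k v" "light_part k u = light_part k v"
    "set u \<union> set v \<subseteq> {..k + 1}" "length u \<le> 3 * k + 3" "length v \<le> 3 * k + 3"
    and "\<And>x. \<theta> x \<noteq> []"
  shows "deducible (bounded_basis k) (subst \<theta> u) (subst \<theta> v)"
proof -
  have "(u, v) \<in> bounded_basis k" using assms by (simp add: bounded_basis_def S1_identity_iff)
  then show ?thesis using assms(8) by (intro deducible.inst deducible.hyp) simp_all
qed

lemma deducible_append_left:
  assumes "deducible \<Sigma> u v"
  shows "deducible \<Sigma> (p @ u) (p @ v)"
  using deducible.cong[OF deducible.refl[of p] assms] assms by (cases "p = []") auto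

lemma deducible_append_right:
  assumes "deducible \<Sigma> u v"
  shows "deducible \<Sigma> (u @ q) (v @ q)"
  using deducible.cong[OF assms deducible.refl[of q]] assms by (cases "q = []") auto

text \<open>A word is an instance of a pattern that only records where \<open>x\<close> occurs: the letter \<open>0\<close> stands for \<open>x\<close>,
and each nonempty block between occurrences of \<open>x\<close> is the image of a letter of its own. Empty blocks get no
letter since substitutions in deductions may not erase.\<close>

lemma blocks_between_occurrences:
  "\<exists>p \<theta>. subst \<theta> p = u \<and> \<theta> 0 = [x] \<and> (\<forall>i. \<theta> i \<noteq> []) \<and> (\<forall>i\<in>set p - {0}. x \<notin> set (\<theta> i)) \<and>
     count_list p 0 = count_list u x \<and> (\<forall>i. i \<noteq> 0 \<longrightarrow> count_list p i \<le> 1) \<and>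
     length p \<le> 2 * count_list u x + 1 \<and> set p \<subseteq> {..count_list u x + 1}"
proof (induction "count_list u x" arbitrary: u)
  case 0
  then have "x \<notin> set u" by (metis count_list_0_iff)
  then show ?case
    using 0 by (cases "u = []")
      (intro exI[of _ "[]"] exI[of _ "\<lambda>_. [x]"] exI[of _ "[1]"] exI[of _ "\<lambda>i. if i = 1 then u else [x]"],
        auto simp: subst_def)+
next
  case (Suc n)
  have "x \<in> set u" using Suc(2) count_list_0_iff[of u x] by fastforce
  then obtain u1 u2 where u: "u = u1 @ x # u2" "x \<notin> set u2" by (meson split_list_last)
  have n: "n = count_list u1 x" "count_list u x = Suc n" using Suc(2) u by (simp_all add: count_list_0_iff)
  obtain p \<theta> where p: "subst \<theta> p = u1" "\<theta> 0 = [x]" "\<forall>i. \<theta> i \<noteq> []" "\<forall>i\<in>set p - {0}. x \<notin> set (\<theta> i)"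
    "count_list p 0 = n" "\<forall>i. i \<noteq> 0 \<longrightarrow> count_list p i \<le> 1" "length p \<le> 2 * n + 1" "set p \<subseteq> {..n + 1}"
    using Suc(1)[OF n(1)] n by metis
  have fresh: "n + 2 \<notin> set p" using p(8) by auto
  have count_fresh: "count_list p (n + 2) = 0" using fresh by (simp add: count_list_0_iff)
  show ?case
  proof (cases "u2 = []")
    case True
    show ?thesis
      by (rule exI[of _ "p @ [0]"], rule exI[of _ \<theta>]) (use p n u True in \<open>auto simp: subst_def\<close>)
  next
    case False
    have "subst (\<theta>(n + 2 := u2)) p = u1"
      using fresh p(1) unfolding subst_def by (metis (mono_tags, lifting) fun_upd_other map_eq_conv)
    then show ?thesis
      by (intro exI[of _ "p @ [0, n + 2]"] exI[of _ "\<theta>(n + 2 := u2)"])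
        (use p n u False fresh count_fresh in \<open>auto simp: subst_def\<close>)
  qed
qed

lemma removeAll_subst:
  assumes "\<theta> 0 = [x]" "\<forall>i\<in>set p - {0}. x \<notin> set (\<theta> i)"
  shows "removeAll x (subst \<theta> p) = subst \<theta> (filter (\<lambda>i. i \<noteq> 0) p)"
  using assms(2) by (induction p) (auto simp: subst_def assms(1))

lemma count_list_replicate: "count_list (replicate n x) y = (if x = y then n else 0)"
  by (induction n) auto

text \<open>The power \<open>x\<^sup>k\<^sup>+\<^sup>1\<close> is formed when reading reaches the occurrence number \<open>k + 1\<close>; afterwards it
commutes with all other letters and absorbs further occurrences of \<open>x\<close>.\<close>

lemma collect_occurrences:
  assumes "0 < k" "k < count_list u x"
  shows "deducible (bounded_basis k) u (removeAll x u @ replicate (Suc k) x)"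
  using assms(2)
proof (induction u rule: rev_induct)
  case (snoc y u)
  let ?X = "replicate (Suc k) x"
  consider "y \<noteq> x" | "y = x" "k < count_list u x" | "y = x" "count_list u x = k"
    using snoc.prems by fastforce
  then show ?case
  proof cases
    case 1
    let ?\<theta> = "\<lambda>i::nat. if i = 0 then [x] else [y]"
    have "deducible (bounded_basis k) (subst ?\<theta> (replicate (Suc k) 0 @ [1])) (subst ?\<theta> (1 # replicate (Suc k) 0))"
      by (rule bounded_basis_instance)
        (use assms(1) in \<open>auto simp: heavy_def light_part_def count_list_replicate\<close>)
    then have "deducible (bounded_basis k) (?X @ [y]) (y # ?X)"
      by (simp add: subst_def)
    from deducible_append_left[OF this, of "removeAll x u"]
      deducible_append_right[of _ u "removeAll x u @ ?X" "[y]"]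
    show ?thesis using 1 snoc by (auto intro: deducible.trans)
  next
    case 2
    let ?\<theta> = "\<lambda>i::nat. [x]"
    have "deducible (bounded_basis k) (subst ?\<theta> (replicate (Suc (Suc k)) 0)) (subst ?\<theta> (replicate (Suc k) 0))"
      by (rule bounded_basis_instance)
        (use assms(1) in \<open>auto simp: heavy_def light_part_def count_list_replicate\<close>)
    then have "deducible (bounded_basis k) (?X @ [x]) ?X"
      by (simp add: subst_def replicate_append_same)
    from deducible_append_left[OF this, of "removeAll x u"]
      deducible_append_right[of _ u "removeAll x u @ ?X" "[y]"]
    show ?thesis using 2 snoc by (auto intro: deducible.trans)
  next
    case 3
    obtain p \<theta> where p: "subst \<theta> p = u" "\<theta> 0 = [x]" "\<forall>i. \<theta> i \<noteq> []" "\<forall>i\<in>set p - {0}. x \<notin> set (\<theta> i)"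
      "count_list p 0 = k" "\<forall>i. i \<noteq> 0 \<longrightarrow> count_list p i \<le> 1" "length p \<le> 2 * k + 1" "set p \<subseteq> {..k + 1}"
      using blocks_between_occurrences[of u x] 3 by metis
    let ?q = "filter (\<lambda>i. i \<noteq> 0) p"
    have heavy: "heavy k (p @ [0]) = {0}" "heavy k (?q @ replicate (Suc k) 0) = {0}"
      using p(5,6) assms(1) by (auto simp: heavy_def count_list_filter count_list_replicate)
    have "deducible (bounded_basis k) (subst \<theta> (p @ [0])) (subst \<theta> (?q @ replicate (Suc k) 0))"
    proof (rule bounded_basis_instance)
      show "heavy k (p @ [0]) = heavy k (?q @ replicate (Suc k) 0)" using heavy by simp
      show "light_part k (p @ [0]) = light_part k (?q @ replicate (Suc k) 0)"
        unfolding light_part_def heavy by simp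
      show "length (?q @ replicate (Suc k) 0) \<le> 3 * k + 3"
        using length_filter_le[of "\<lambda>i. i \<noteq> 0" p] p(7)
        unfolding length_append length_replicate by linarith
    qed (use p(3,7,8) in auto)
    moreover have "removeAll x u = subst \<theta> ?q"
      using removeAll_subst[OF p(2,4)] p(1) by simp
    moreover have "subst \<theta> (replicate (Suc k) 0) = ?X"
      using p(2) by (simp add: subst_def map_replicate concat_replicate_single)
    ultimately show ?thesis
      using 3 p(1,2) by (simp add: subst_def)
  qed
qed simp

lemma removeAll_heavy:
  assumes "x \<in> heavy k u"
  shows "heavy k (removeAll x u) = heavy k u - {x}" and "light_part k (removeAll x u) = light_part k u"
proof -
  have "removeAll x u = filter (\<lambda>y. y \<noteq> x) u" by (induction u) auto
  then show heavy: "heavy k (removeAll x u) = heavy k u - {x}"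
    by (auto simp: heavy_def count_list_filter)
  show "light_part k (removeAll x u) = light_part k u"
    unfolding light_part_def heavy unfolding \<open>removeAll x u = _\<close> filter_filter
    using assms by (intro filter_cong) auto
qed

lemma set_heavy_light: "set u = heavy k u \<union> set (light_part k u)"
proof -
  have "x \<in> set u" if "x \<in> heavy k u" for x
    using that count_list_0_iff[of u x] by (cases "x \<in> set u") (auto simp: heavy_def)
  then show ?thesis by (auto simp: light_part_def)
qed

lemma bounded_basis_complete:
  assumes "0 < k" "u \<noteq> []" "v \<noteq> []" "heavy k u = heavy k v" "light_part k u = light_part k v"
  shows "deducible (bounded_basis k) u v"
  using assms(2-)
proof (induction "card (heavy k u)" arbitrary: u v)
  case 0
  moreover have "finite (heavy k u)"
    using set_heavy_light[of u k] by (metis finite_Un finite_set)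
  ultimately have "heavy k u = {}" by simp
  with 0 have "u = v" by (simp add: light_part_def)
  then show ?case using 0 by (simp add: deducible.refl)
next
  case (Suc n)
  then obtain x where x: "x \<in> heavy k u" by (metis card.empty ex_in_conv nat.distinct(1))
  let ?X = "replicate (Suc k) x"
  have u: "deducible (bounded_basis k) u (removeAll x u @ ?X)"
    and v: "deducible (bounded_basis k) v (removeAll x v @ ?X)"
    using collect_occurrences[OF assms(1)] x Suc.prems(3) by (auto simp: heavy_def)
  have "set u = set v" using set_heavy_light[of u k] set_heavy_light[of v k] Suc.prems by simp
  then have "set (removeAll x u) = set (removeAll x v)" by (simp only: set_removeAll)
  then have empty_iff: "removeAll x u = [] \<longleftrightarrow> removeAll x v = []" by (metis set_empty)
  have "deducible (bounded_basis k) (removeAll x u @ ?X) (removeAll x v @ ?X)"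
  proof (cases "removeAll x u = []")
    case True
    with empty_iff show ?thesis by (simp add: deducible.refl)
  next
    case False
    have "n = card (heavy k (removeAll x u))"
      using Suc.hyps(2) x by (simp add: removeAll_heavy)
    then show ?thesis
      using False empty_iff x Suc.prems by (intro deducible_append_right Suc.hyps(1)) (simp_all add: removeAll_heavy)
  qed
  with u v show ?case by (meson deducible.sym deducible.trans)
qed


theorem bounded_words_finitely_based:
  assumes "0 < k"
  shows "finitely_based_words (bounded_words k)"
  unfolding finitely_based_words_def finitely_based_def
proof (intro exI[of _ "bounded_basis k"] conjI)
  show "bounded_basis k \<subseteq> sg_identities (semigroup_of (S1 (bounded_words k)))"
    by (auto simp: bounded_basis_def)
  show "\<forall>(u, v) \<in> sg_identities (semigroup_of (S1 (bounded_words k))). deducible (bounded_basis k) u v"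
    using bounded_basis_complete[OF assms] by (auto simp: S1_identity_iff)
qed (rule finite_bounded_basis)

section \<open>The monoids for lengths three and five\<close>

theorem corollary6p2:
  shows "\<not> finitely_based (semigroup_of (L1 3)) \<and> \<not> finitely_based (semigroup_of (L1 5)) \<and>
    finitely_based_words (Isot (L1 3)) \<and> finitely_based_words (Isot (L1 5))"
proof -
  have "Isot (L1 3) = bounded_words 1" "Isot (L1 5) = bounded_words 2"
    using Isot_L1[of 1] Isot_L1[of 2] by (simp_all add: numeral_eq_Suc)
  then show ?thesis
    using L1_not_finitely_based[of 3] L1_not_finitely_based[of 5] bounded_words_finitely_based
    by simp
qed

end
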